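(* Let $(W,S)$ be a Coxeter system of rank $n$ whose associated bilinear form $B$ has signature $(n-1,1)$ and is irreducible. Let $\partial_G W$ be the Gromov boundary of $W$ (with respect to the word metric of $S$) and let $\Lambda(W)\subset \partial D$ be the limit set of $W$ for the normalized action. Then there exists a $W$-equivariant continuous surjection $F:\partial_G W\to \Lambda(W)$.
   Context: Coxeter data. $W$ is generated by $S=\{s_1,\dots,s_n\}$ subject only to the relations $(s_is_j)^{m_{ij}}=1$, with $m_{ii}=1$ and $m_{ij}=m_{ji}\in\mathbb{Z}_{>1}\cup\{\infty\}$ for $i\ne j$ (no relation if $m_{ij}=\infty$). $V$ is a real vector space with basis $\Delta=\{\alpha_1,\dots,\alpha_n\}$, orthonormal for the Euclidean inner product. The associated bilinear form $B$ is a symmetric bilinear form with $B(\alpha_i,\alpha_j)=-\cos(\pi/m_{ij})$ if $m_{ij}<\infty$ and $B(\alpha_i,\alpha_j)$ a chosen real number $\le -1$ if $m_{ij}=\infty$. $W$ acts linearly on $V$, $s_i$ acting by $s_i(v)=v-2B(\alpha_i,v)\alpha_i$. Signature $(p,q)$ means $p$ positive and $q$ negative eigenvalues of the Gram matrix $(B(\alpha_i,\alpha_j))$ (counted with multiplicity). $B$ is irreducible if this matrix is not block-diagonal up to permutation of the basis. Normalized action. Let $o=\sum_i o_i\alpha_i$ be the eigenvector of $B$ for its negative eigenvalue with Euclidean norm $1$ and all $o_i>0$ (it exists and is unique by Perron-Frobenius). For $v=\sum v_i\alpha_i$ put $|v|_1=\sum_i o_iv_i$, $V_i=\{v: |v|_1=i\}$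 ($i=0,1$), and $\widehat v=v/|v|_1$ for $v\notin V_0$. The normalized action is $w\cdot v=\widehat{w(v)}$. Put $D=\{v\in V_1: B(v,v)<0\}$; it is an open ellipsoid in $V_1$ containing $o$, with boundary $\partial D=\{v\in V_1: B(v,v)=0\}$ in $V_1$, and the normalized action is defined on and preserves $D$ and $\partial D$. The limit set $\Lambda(W)$ is the set of accumulation points (in the Euclidean topology of $V_1$) of the orbit $W\cdot o$; it is contained in $\partial D$ and carries the subspace topology. Gromov boundary. For a metric space $(X,d)$ put $(x|y)_z=\frac12(d(x,z)+d(y,z)-d(x,y))$ and fix a base point, omitted from the notation. A sequence $x=\{x_i\}$ is a Gromov sequence if $(x_i|x_j)\to\infty$ as $i,j\to\infty$. For Gromov sequences write $x\sim_G y$ if $\liminf_{i,j\to\infty}(x_i|y_j)=\infty$, and let $\sim$ be the transitive closure of $\sim_G$. $\partial_GX$ is the set of $\sim$-classes. For $a,b\in\partial_GX$ put $(a|b)=\inf\{\liminf_{i,j\to\infty}(x_i|y_j): [x]=a,[y]=b\}$ if $a\ne b$, and $(a|a)=\infty$. The topology of $\partial_GX$ has subbasis $U(a,r)=\{b\in\partial_GX:(a|b)>r\}$, $a\in\partial_GX$, $r>0$. $\partial_GW$ is this boundary for $W$ with the word metric $d(g,h)=|g^{-1}h|$ with respect to $S$ and base point the identity. $W$ acts on $\partial_GW$ by left multiplication of sequences and on $\Lambda(W)$ by the normalized action; a map $f$ is $W$-equivariant if $g\cdot f(x)=f(g\cdot x)$ for all $g\in W$ and all $x$. *)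

theory Defs
  imports "HOL-Analysis.Analysis" "HOL-Algebra.Generated_Groups"
begin

section \<open>Coxeter systems\<close>

definition coxeter_matrix :: "('n \<Rightarrow> 'n \<Rightarrow> enat) \<Rightarrow> bool" where
  "coxeter_matrix m \<longleftrightarrow>
     (\<forall>i. m i i = 1) \<and> (\<forall>i j. m i j = m j i) \<and> (\<forall>i j. i \<noteq> j \<longrightarrow> m i j > 1)"

text \<open>The congruence on words over the index set generated by the relations
  \<open>(s\<^sub>i s\<^sub>j)\<^sup>k = 1\<close> for \<open>k = m\<^sub>i\<^sub>j < \<infinity>\<close>. Since the relations contain \<open>s\<^sub>i s\<^sub>i = 1\<close>, formal
  inverses of the generators are not needed, and the quotient is the group with
  this presentation.\<close>

inductive coxeter_cong :: "('n \<Rightarrow> 'n \<Rightarrow> enat) \<Rightarrow> 'n list \<Rightarrow> 'n list \<Rightarrow> bool"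
  for m where
  relator: "m i j = enat k \<Longrightarrow> coxeter_cong m (u @ concat (replicate k [i, j]) @ v) (u @ v)"
| refl: "coxeter_cong m u u"
| sym: "coxeter_cong m u v \<Longrightarrow> coxeter_cong m v u"
| trans: "coxeter_cong m u v \<Longrightarrow> coxeter_cong m v w \<Longrightarrow> coxeter_cong m u w"

definition word_prod :: "('a, 'b) monoid_scheme \<Rightarrow> ('n \<Rightarrow> 'a) \<Rightarrow> 'n list \<Rightarrow> 'a" where
  "word_prod G s u = foldr (\<lambda>i g. s i \<otimes>\<^bsub>G\<^esub> g) u \<one>\<^bsub>G\<^esub>"

definition coxeter_system ::
  "('a, 'b) monoid_scheme \<Rightarrow> ('n::finite \<Rightarrow> 'a) \<Rightarrow> ('n \<Rightarrow> 'n \<Rightarrow> enat) \<Rightarrow> bool" where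
  "coxeter_system G s m \<longleftrightarrow>
     coxeter_matrix m \<and> group G \<and> range s \<subseteq> carrier G \<and>
     generate G (range s) = carrier G \<and>
     (\<forall>u v. word_prod G s u = word_prod G s v \<longleftrightarrow> coxeter_cong m u v)"

definition word_length :: "('a, 'b) monoid_scheme \<Rightarrow> ('n \<Rightarrow> 'a) \<Rightarrow> 'a \<Rightarrow> nat" where
  "word_length G s g = (LEAST k. \<exists>u. length u = k \<and> word_prod G s u = g)"

definition word_dist :: "('a, 'b) monoid_scheme \<Rightarrow> ('n \<Rightarrow> 'a) \<Rightarrow> 'a \<Rightarrow> 'a \<Rightarrow> real" where
  "word_dist G s g h = real (word_length G s (inv\<^bsub>G\<^esub> g \<otimes>\<^bsub>G\<^esub> h))"


section \<open>The associated bilinear form\<close>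

text \<open>\<open>V\<close> is \<open>real ^ 'n\<close> with its standard inner product, so its simple roots are the
  standard basis vectors.\<close>

abbreviation simple_root :: "'n \<Rightarrow> real ^ 'n::finite" where
  "simple_root i \<equiv> axis i 1"

definition associated_form ::
  "('n::finite \<Rightarrow> 'n \<Rightarrow> enat) \<Rightarrow> (real ^ 'n \<Rightarrow> real ^ 'n \<Rightarrow> real) \<Rightarrow> bool" where
  "associated_form m B \<longleftrightarrow>
     bilinear B \<and> (\<forall>u v. B u v = B v u) \<and>
     (\<forall>i j. case m i j of
        enat k \<Rightarrow> B (simple_root i) (simple_root j) = - cos (pi / real k)
      | \<infinity> \<Rightarrow> B (simple_root i) (simple_root j) \<le> -1)"

definition gram :: "(real ^ 'n \<Rightarrow> real ^ 'n \<Rightarrow> real) \<Rightarrow> real ^ 'n ^ 'n::finite" where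
  "gram B = (\<chi> i j. B (simple_root i) (simple_root j))"

definition eigenspace :: "real ^ 'n ^ 'n \<Rightarrow> real \<Rightarrow> (real ^ 'n::finite) set" where
  "eigenspace A c = {v. A *v v = c *\<^sub>R v}"

definition eigenvalues :: "real ^ 'n ^ 'n::finite \<Rightarrow> real set" where
  "eigenvalues A = {c. \<exists>v. v \<noteq> 0 \<and> v \<in> eigenspace A c}"

text \<open>The matrices considered are symmetric, so the geometric multiplicity used here is
  also the algebraic one.\<close>

definition matrix_signature :: "real ^ 'n ^ 'n::finite \<Rightarrow> nat \<times> nat" where
  "matrix_signature A =
     (\<Sum>c | c \<in> eigenvalues A \<and> c > 0. dim (eigenspace A c),
      \<Sum>c | c \<in> eigenvalues A \<and> c < 0. dim (eigenspace A c))"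

text \<open>The set \<open>I\<close> collects the indices of one diagonal block and its complement those of
  the other.\<close>

definition irreducible_matrix :: "real ^ 'n ^ 'n::finite \<Rightarrow> bool" where
  "irreducible_matrix A \<longleftrightarrow>
     \<not> (\<exists>I. I \<noteq> {} \<and> I \<noteq> UNIV \<and> (\<forall>i\<in>I. \<forall>j\<in>-I. A $ i $ j = 0 \<and> A $ j $ i = 0))"


section \<open>The normalized action and the limit set\<close>

definition reflection ::
  "(real ^ 'n \<Rightarrow> real ^ 'n \<Rightarrow> real) \<Rightarrow> 'n::finite \<Rightarrow> real ^ 'n \<Rightarrow> real ^ 'n" where
  "reflection B i v = v - (2 * B (simple_root i) v) *\<^sub>R simple_root i"

text \<open>\<open>g\<close> acts by the product of the reflections along any word representing it; the
  result does not depend on the word.\<close>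

definition linear_act ::
  "('a, 'b) monoid_scheme \<Rightarrow> ('n::finite \<Rightarrow> 'a) \<Rightarrow> (real ^ 'n \<Rightarrow> real ^ 'n \<Rightarrow> real)
     \<Rightarrow> 'a \<Rightarrow> real ^ 'n \<Rightarrow> real ^ 'n" where
  "linear_act G s B g v =
     (THE v'. \<exists>u. word_prod G s u = g \<and> v' = foldr (reflection B) u v)"

definition o_vec :: "(real ^ 'n \<Rightarrow> real ^ 'n \<Rightarrow> real) \<Rightarrow> real ^ 'n::finite" where
  "o_vec B = (THE v. (\<exists>c<0. v \<in> eigenspace (gram B) c) \<and> norm v = 1 \<and> (\<forall>i. v $ i > 0))"

definition norm1 :: "(real ^ 'n \<Rightarrow> real ^ 'n \<Rightarrow> real) \<Rightarrow> real ^ 'n::finite \<Rightarrow> real" where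
  "norm1 B v = (\<Sum>i\<in>UNIV. o_vec B $ i * v $ i)"

definition V1 :: "(real ^ 'n \<Rightarrow> real ^ 'n \<Rightarrow> real) \<Rightarrow> (real ^ 'n::finite) set" where
  "V1 B = {v. norm1 B v = 1}"

text \<open>On \<open>V\<^sub>0\<close>, where the normalization is not defined, this takes the value \<open>0\<close>.\<close>

definition normalize_vec :: "(real ^ 'n \<Rightarrow> real ^ 'n \<Rightarrow> real) \<Rightarrow> real ^ 'n \<Rightarrow> real ^ 'n::finite" where
  "normalize_vec B v = v /\<^sub>R norm1 B v"

definition normalized_act ::
  "('a, 'b) monoid_scheme \<Rightarrow> ('n::finite \<Rightarrow> 'a) \<Rightarrow> (real ^ 'n \<Rightarrow> real ^ 'n \<Rightarrow> real)
     \<Rightarrow> 'a \<Rightarrow> real ^ 'n \<Rightarrow> real ^ 'n" where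
  "normalized_act G s B g v = normalize_vec B (linear_act G s B g v)"

definition limit_set ::
  "('a, 'b) monoid_scheme \<Rightarrow> ('n::finite \<Rightarrow> 'a) \<Rightarrow> (real ^ 'n \<Rightarrow> real ^ 'n \<Rightarrow> real)
     \<Rightarrow> (real ^ 'n) set" where
  "limit_set G s B =
     {x \<in> V1 B. x islimpt (\<lambda>g. normalized_act G s B g (o_vec B)) ` carrier G}"


section \<open>The Gromov boundary\<close>

text \<open>The metric space has carrier \<open>X\<close>, distance \<open>d\<close> and base point \<open>z\<close>.\<close>

definition gromov_product :: "('a \<Rightarrow> 'a \<Rightarrow> real) \<Rightarrow> 'a \<Rightarrow> 'a \<Rightarrow> 'a \<Rightarrow> real" where
  "gromov_product d z x y = (d x z + d y z - d x y) / 2"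

definition gromov_sequences :: "'a set \<Rightarrow> ('a \<Rightarrow> 'a \<Rightarrow> real) \<Rightarrow> 'a \<Rightarrow> (nat \<Rightarrow> 'a) set" where
  "gromov_sequences X d z =
     {x. range x \<subseteq> X \<and>
         filterlim (\<lambda>(i, j). gromov_product d z (x i) (x j)) at_top
           (sequentially \<times>\<^sub>F sequentially)}"

definition liminf_product ::
  "('a \<Rightarrow> 'a \<Rightarrow> real) \<Rightarrow> 'a \<Rightarrow> (nat \<Rightarrow> 'a) \<Rightarrow> (nat \<Rightarrow> 'a) \<Rightarrow> ereal" where
  "liminf_product d z x y =
     Liminf (sequentially \<times>\<^sub>F sequentially) (\<lambda>(i, j). ereal (gromov_product d z (x i) (y j)))"

definition gromov_rel ::
  "'a set \<Rightarrow> ('a \<Rightarrow> 'a \<Rightarrow> real) \<Rightarrow> 'a \<Rightarrow> ((nat \<Rightarrow> 'a) \<times> (nat \<Rightarrow> 'a)) set" where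
  "gromov_rel X d z =
     {(x, y). x \<in> gromov_sequences X d z \<and> y \<in> gromov_sequences X d z \<and>
              liminf_product d z x y = \<infinity>}"

definition gromov_boundary ::
  "'a set \<Rightarrow> ('a \<Rightarrow> 'a \<Rightarrow> real) \<Rightarrow> 'a \<Rightarrow> (nat \<Rightarrow> 'a) set set" where
  "gromov_boundary X d z = gromov_sequences X d z // (gromov_rel X d z)\<^sup>+"

definition boundary_product ::
  "('a \<Rightarrow> 'a \<Rightarrow> real) \<Rightarrow> 'a \<Rightarrow> (nat \<Rightarrow> 'a) set \<Rightarrow> (nat \<Rightarrow> 'a) set \<Rightarrow> ereal" where
  "boundary_product d z a b =
     (if a = b then \<infinity> else (INF (x, y) \<in> a \<times> b. liminf_product d z x y))"

definition gromov_topology ::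
  "'a set \<Rightarrow> ('a \<Rightarrow> 'a \<Rightarrow> real) \<Rightarrow> 'a \<Rightarrow> (nat \<Rightarrow> 'a) set topology" where
  "gromov_topology X d z =
     topology_generated_by
       {{b \<in> gromov_boundary X d z. boundary_product d z a b > ereal r} | a r.
          a \<in> gromov_boundary X d z \<and> r > 0}"

text \<open>Left multiplication is an isometry, so the image of a class is again a class.\<close>

definition boundary_act ::
  "('a, 'b) monoid_scheme \<Rightarrow> 'a \<Rightarrow> (nat \<Rightarrow> 'a) set \<Rightarrow> (nat \<Rightarrow> 'a) set" where
  "boundary_act G g a = (\<lambda>x i. g \<otimes>\<^bsub>G\<^esub> x i) ` a"

abbreviation group_boundary ::
  "('a, 'b) monoid_scheme \<Rightarrow> ('n \<Rightarrow> 'a) \<Rightarrow> (nat \<Rightarrow> 'a) set set" where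
  "group_boundary G s \<equiv> gromov_boundary (carrier G) (word_dist G s) \<one>\<^bsub>G\<^esub>"

abbreviation group_boundary_topology ::
  "('a, 'b) monoid_scheme \<Rightarrow> ('n \<Rightarrow> 'a) \<Rightarrow> (nat \<Rightarrow> 'a) set topology" where
  "group_boundary_topology G s \<equiv> gromov_topology (carrier G) (word_dist G s) \<one>\<^bsub>G\<^esub>"

end

theory Submission
  imports Defs
begin

text \<open>The map sends the class of a Gromov sequence \<open>x\<close> to the limit of the orbit points \<open>x\<^sub>i \<cdot> o\<close>.
  Everything rests on one estimate, \<open>gromov_product_contraction\<close>: if \<open>(g|h) \<ge> R\<close>, then
  \<open>g \<cdot> o\<close> and \<open>h \<cdot> o\<close> are within \<open>\<epsilon>(R)\<close> of each other, where \<open>\<epsilon>(R) \<rightarrow> 0\<close>. It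
  makes orbit points along a Gromov sequence a Cauchy sequence, identifies the limits of equivalent
  sequences, and gives continuity, because a basic neighbourhood of a boundary point is defined by a
  lower bound for Gromov products. Surjectivity is a compactness argument: elements whose orbit points
  converge have reduced words with longer and longer common prefixes along a subsequence, and such
  a subsequence is a Gromov sequence. Equivariance is continuity of the linear action.

  The estimate follows an idea of Floyd. A geodesic of the Cayley graph from \<open>g\<close> to \<open>h\<close> stays outside the
  ball of radius \<open>(g|h)\<close> about the identity, and lower bounds for its distance from the identity grow
  at unit speed towards both ends. So it suffices that an edge at distance \<open>k\<close> from the identity is
  mapped to a segment of length at most \<open>\<phi>(k)\<close> with \<open>\<phi>\<close> decreasing and summable; the sum along the
  geodesic is then bounded by tails of the series.

  Let \<open>\<nu>(v)\<close> be the linear functional that defines the normalization. The form is positive definite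
  on the hyperplane \<open>\<nu> = 0\<close>, which contains the difference of two normalized points, so an edge from
  \<open>g\<close> to \<open>g s\<^sub>i\<close> has length at most a constant times \<open>1/\<nu>(g o) + 1/\<nu>(g s\<^sub>i o)\<close>
  (\<open>orbit_point_step\<close>). What remains is superlinear growth of the height \<open>\<nu>(g o)\<close> in the word length
  (\<open>reduced_height_growth\<close>).

  For a reduced word \<open>s\<^sub>1 \<dots> s\<^sub>k\<close> of \<open>g\<close>, the vector \<open>g o - o\<close> is a combination of the \<open>k\<close> inversion roots
  \<open>s\<^sub>1 \<dots> s\<^sub>j\<^sub>-\<^sub>1 \<alpha>\<^sub>j\<close> with coefficients bounded below. These roots are positive by the theorem of Tits
  (\<open>reduced_root_nonneg\<close>), and they belong to \<open>k\<close> different reflections. Distinct orbit points \<open>g o\<close> in \<open>V\<close>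
  are uniformly separated in the Euclidean metric, and their norms are controlled by their heights, so
  only polynomially many group elements have height at most \<open>T\<close> (\<open>orbit_count\<close>). Applied to the \<open>k\<close>
  reflections, this forces at least half of the roots to have height at least of the order of a
  positive power of \<open>k\<close>; summing up, \<open>\<nu>(g o)\<close> is at least of the order of \<open>k\<close> to a power greater than one.\<close>


section \<open>Words in a Coxeter presentation\<close>

fun alternating_word :: "'n \<Rightarrow> 'n \<Rightarrow> nat \<Rightarrow> 'n list" where
  "alternating_word x y 0 = []"
| "alternating_word x y (Suc k) = x # alternating_word y x k"

lemma length_alternating_word [simp]: "length (alternating_word x y k) = k"
  by (induction x y k rule: alternating_word.induct) auto

lemma take_alternating_word: "take k (alternating_word x y (k + l)) = alternating_word x y k"
  by (induction x y k rule: alternating_word.induct) auto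

lemma alternating_word_double:
  "alternating_word x y (2 * k) = concat (replicate k [x, y])"
  by (induction k) auto

locale coxeter_words =
  fixes m :: "'n \<Rightarrow> 'n \<Rightarrow> enat"
  assumes matrix: "coxeter_matrix m"
begin

abbreviation cong_word (infix "\<asymp>" 50) where "u \<asymp> v \<equiv> coxeter_cong m u v"

lemma m_diag: "m i i = enat 1"
  using matrix by (simp add: coxeter_matrix_def one_enat_def)

lemma m_sym: "m i j = m j i"
  using matrix by (simp add: coxeter_matrix_def)

lemma m_offdiag: "i \<noteq> j \<Longrightarrow> m i j = enat k \<Longrightarrow> 2 \<le> k"
proof -
  assume "i \<noteq> j" "m i j = enat k"
  then have "1 < enat k"
    using matrix by (metis coxeter_matrix_def)
  then show "2 \<le> k"
    by (simp add: one_enat_def)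
qed

lemma cong_context: "u \<asymp> v \<Longrightarrow> x @ u @ y \<asymp> x @ v @ y"
proof (induction rule: coxeter_cong.induct)
  case (relator i j k u v)
  show ?case
    using coxeter_cong.relator[of m i j k "x @ u" "v @ y", OF relator] by simp
qed (auto intro: coxeter_cong.intros)

lemma cong_append: "u \<asymp> u' \<Longrightarrow> v \<asymp> v' \<Longrightarrow> u @ v \<asymp> u' @ v'"
  using cong_context[of u u' "[]" v] cong_context[of v v' u' "[]"]
  by (auto intro: coxeter_cong.trans)

lemma cong_square: "u @ [i, i] @ v \<asymp> u @ v"
  using coxeter_cong.relator[of m i i 1 u v] m_diag by simp

lemma cong_rev_self: "rev u @ u \<asymp> []"
proof (induction u)
  case (Cons i u)
  have "rev u @ [i, i] @ u \<asymp> rev u @ u"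
    by (rule cong_square)
  then show ?case
    using Cons by (auto intro: coxeter_cong.trans)
qed (auto intro: coxeter_cong.refl)

lemma cong_self_rev: "u @ rev u \<asymp> []"
  using cong_rev_self[of "rev u"] by simp

text \<open>Every relator has even length. This is the sign character of the group.\<close>

lemma cong_parity: "u \<asymp> v \<Longrightarrow> even (length u) \<longleftrightarrow> even (length v)"
  by (induction rule: coxeter_cong.induct) (auto simp: length_concat sum_list_replicate)

definition reduced :: "'n list \<Rightarrow> bool" where
  "reduced u \<longleftrightarrow> (\<forall>v. u \<asymp> v \<longrightarrow> length u \<le> length v)"

lemma reducedD: "reduced u \<Longrightarrow> u \<asymp> v \<Longrightarrow> length u \<le> length v"
  by (simp add: reduced_def)

lemma ex_reduced: "\<exists>v. u \<asymp> v \<and> reduced v"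
proof -
  obtain v where "u \<asymp> v" "\<And>w. u \<asymp> w \<Longrightarrow> length v \<le> length w"
    using ex_has_least_nat[of "coxeter_cong m u" u length] coxeter_cong.refl by blast
  then show ?thesis
    unfolding reduced_def by (meson coxeter_cong.trans)
qed

lemma reduced_cong: "reduced u \<Longrightarrow> u \<asymp> v \<Longrightarrow> length v \<le> length u \<Longrightarrow> reduced v"
  unfolding reduced_def by (meson coxeter_cong.trans le_trans)

lemma reduced_appendD1: "reduced (u @ v) \<Longrightarrow> reduced u"
  unfolding reduced_def
  by (metis add_le_cancel_right coxeter_cong.refl cong_append length_append)

lemma reduced_appendD2: "reduced (u @ v) \<Longrightarrow> reduced v"
  unfolding reduced_def
  by (metis add_le_cancel_left coxeter_cong.refl cong_append length_append)

lemma not_reduced_square: "\<not> reduced (u @ [i, i] @ v)"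
  using cong_square[of u i v] reducedD by fastforce

text \<open>Lengths of congruent words have the same parity, so multiplying by a generator changes
  the length of an element by exactly one; if it goes down, the element has a reduced word ending
  in that generator.\<close>

lemma not_reduced_snoc:
  assumes "reduced u" "\<not> reduced (u @ [i])"
  obtains v where "reduced (v @ [i])" "u \<asymp> v @ [i]" "length u = Suc (length v)"
proof -
  obtain v where v: "u @ [i] \<asymp> v" "reduced v"
    using ex_reduced by blast
  have "length v < Suc (length u)"
    using assms(2) v reduced_cong[of v "u @ [i]"]
    by (metis coxeter_cong.sym length_append_singleton not_less)
  moreover have "even (length v) \<longleftrightarrow> odd (length u)"
    using cong_parity[OF v(1)] by simp
  ultimately have le: "Suc (length v) \<le> length u"
    by (metis Suc_leI less_SucE)
  have "u \<asymp> (u @ [i]) @ [i]"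
    using cong_square[of u i "[]"] coxeter_cong.sym by fastforce
  then have c: "u \<asymp> v @ [i]"
    using cong_append[OF v(1) coxeter_cong.refl] by (rule coxeter_cong.trans)
  have "reduced (v @ [i])"
    using reduced_cong[OF assms(1) c] le by simp
  moreover have "length u = Suc (length v)"
    using reducedD[OF assms(1) c] le by simp
  ultimately show ?thesis
    using that c by blast
qed

text \<open>From \<open>(x y)\<^sup>k = 1\<close>, the alternating word of length \<open>k + 1\<close> equals the reverse of the
  remaining \<open>k - 1\<close> letters of the relator.\<close>

lemma reduced_alternating_bound:
  assumes "reduced (alternating_word x y l)" "m x y = enat k" "0 < k"
  shows "l \<le> k"
proof (rule ccontr)
  assume "\<not> l \<le> k"
  then obtain d where l: "l = Suc k + d"
    using less_imp_Suc_add not_le by force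
  define p where "p = alternating_word x y (Suc k)"
  define q where "q = drop (Suc k) (alternating_word x y (2 * k))"
  have p_take: "p = take (Suc k) (alternating_word x y (2 * k))"
    using take_alternating_word[of "Suc k" x y "k - 1"] assms(3)
    by (simp add: p_def mult_2)
  have "p @ q = concat (replicate k [x, y])"
    by (simp add: p_take q_def flip: alternating_word_double)
  then have pq: "p @ q \<asymp> []"
    using coxeter_cong.relator[of m x y k "[]" "[]"] assms(2) by simp
  have "p = take (Suc k) (alternating_word x y l)"
    using take_alternating_word[of "Suc k" x y d] by (simp add: p_def l)
  then have "reduced p"
    using assms(1) reduced_appendD1 by (metis append_take_drop_id)
  moreover have "p \<asymp> rev q"
  proof -
    have "p \<asymp> p @ (q @ rev q)"
      using cong_append[OF coxeter_cong.refl cong_self_rev, of p q] coxeter_cong.sym by fastforce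
    moreover have "p @ (q @ rev q) \<asymp> rev q"
      using cong_append[OF pq coxeter_cong.refl, of "rev q"] by simp
    ultimately show ?thesis
      by (rule coxeter_cong.trans)
  qed
  ultimately have "length p \<le> length q"
    using reducedD by fastforce
  then show False
    using assms(3) by (simp add: p_def q_def)
qed

end


section \<open>The geometric representation and positivity of roots\<close>

lemma sin_add_step: "sin (a + t) = 2 * cos t * sin a - sin (a - t)" for a t :: real
  by (simp add: sin_add sin_diff)

text \<open>Chebyshev polynomials of the second kind, shifted by one: they are the coordinates of the
  roots of a dihedral group with respect to its two simple roots.\<close>

fun chebyshev :: "real \<Rightarrow> nat \<Rightarrow> real" where
  "chebyshev c 0 = 0"
| "chebyshev c (Suc 0) = 1"
| "chebyshev c (Suc (Suc k)) = 2 * c * chebyshev c (Suc k) - chebyshev c k"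

lemma sin_chebyshev: "sin t * chebyshev (cos t) k = sin (real k * t)"
proof (induction "cos t" k rule: chebyshev.induct)
  case (3 k)
  have "sin (real (Suc (Suc k)) * t) = sin (real (Suc k) * t + t)"
    by (simp add: algebra_simps)
  also have "\<dots> = 2 * cos t * sin (real (Suc k) * t) - sin (real (Suc k) * t - t)"
    by (rule sin_add_step)
  also have "real (Suc k) * t - t = real k * t"
    by (simp add: algebra_simps)
  finally show ?case
    using 3 by (simp add: algebra_simps)
qed auto

lemma chebyshev_nonneg_finite:
  assumes "2 \<le> k" "l \<le> k"
  shows "0 \<le> chebyshev (cos (pi / real k)) l"
proof -
  have "0 < sin (pi / real k)"
    using assms by (intro sin_gt_zero) (auto simp: field_simps)
  moreover have "0 \<le> sin (real l * (pi / real k))"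
    using assms by (intro sin_ge_zero) (auto simp: field_simps)
  ultimately show ?thesis
    by (metis sin_chebyshev zero_le_mult_iff not_less)
qed

lemma chebyshev_mono:
  assumes "1 \<le> c"
  shows "0 \<le> chebyshev c k \<and> chebyshev c k \<le> chebyshev c (Suc k)"
proof (induction k)
  case (Suc k)
  have "1 * chebyshev c (Suc k) \<le> c * chebyshev c (Suc k)"
    using Suc assms by (intro mult_right_mono) linarith+
  then show ?case
    using Suc by simp
qed auto

locale coxeter_form = coxeter_words m
  for m :: "'n::finite \<Rightarrow> 'n \<Rightarrow> enat" +
  fixes B :: "real ^ 'n \<Rightarrow> real ^ 'n \<Rightarrow> real"
  assumes form: "associated_form m B"
begin

lemma bilinear_B: "bilinear B"
  using form by (simp add: associated_form_def)

lemma bounded_bilinear_B: "bounded_bilinear B"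
  using bilinear_B bilinear_conv_bounded_bilinear by blast

sublocale B: bounded_bilinear B
  by (rule bounded_bilinear_B)

lemma B_commute: "B u v = B v u"
proof -
  have "\<forall>u v. B u v = B v u"
    using form unfolding associated_form_def by (elim conjE)
  then show ?thesis
    by (elim allE)
qed

lemma B_root_cases:
  "case m i j of enat k \<Rightarrow> B (simple_root i) (simple_root j) = - cos (pi / real k)
    | \<infinity> \<Rightarrow> B (simple_root i) (simple_root j) \<le> -1"
proof -
  have "\<forall>i j. case m i j of enat k \<Rightarrow> B (simple_root i) (simple_root j) = - cos (pi / real k)
    | \<infinity> \<Rightarrow> B (simple_root i) (simple_root j) \<le> -1"
    using form unfolding associated_form_def by (elim conjE)
  then show ?thesis
    by (elim allE)
qed

lemma B_root_finite: "m i j = enat k \<Longrightarrow> B (simple_root i) (simple_root j) = - cos (pi / real k)"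
  using B_root_cases[of i j] by simp

lemma B_root_infinite: "m i j = \<infinity> \<Longrightarrow> B (simple_root i) (simple_root j) \<le> -1"
  using B_root_cases[of i j] by simp

lemma B_root_self [simp]: "B (simple_root i) (simple_root i) = 1"
  using B_root_finite[OF m_diag] by simp

lemma B_root_nonpos:
  assumes "i \<noteq> j"
  shows "B (simple_root i) (simple_root j) \<le> 0"
proof (cases "m i j")
  case (enat k)
  then have "pi / real k \<le> pi / 2"
    using m_offdiag[OF assms] by (intro divide_left_mono) auto
  moreover have "- (pi / 2) \<le> pi / real k"
    by (rule order_trans[of _ 0]) simp_all
  ultimately have "0 \<le> cos (pi / real k)"
    by (intro cos_ge_zero) auto
  then show ?thesis
    using B_root_finite[OF enat] by simp
next
  case infinity
  then show ?thesis
    using B_root_infinite[OF infinity] by simp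
qed

abbreviation reflect :: "'n \<Rightarrow> real ^ 'n \<Rightarrow> real ^ 'n" where "reflect \<equiv> reflection B"

abbreviation act :: "'n list \<Rightarrow> real ^ 'n \<Rightarrow> real ^ 'n" where "act u \<equiv> foldr reflect u"

lemma refl_add: "reflect i (u + v) = reflect i u + reflect i v"
  by (simp add: reflection_def B.add_right algebra_simps)

lemma refl_scale: "reflect i (c *\<^sub>R v) = c *\<^sub>R reflect i v"
  by (simp add: reflection_def B.scaleR_right algebra_simps)

lemma refl_refl [simp]: "reflect i (reflect i v) = v"
  by (simp add: reflection_def B.diff_right B.scaleR_right algebra_simps)

lemma B_refl: "B (reflect i u) (reflect i v) = B u v"
  using B_commute[of u "simple_root i"]
  by (simp add: reflection_def B.diff_right B.diff_left B.scaleR_right B.scaleR_left algebra_simps)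

lemma linear_act: "linear (act u)"
proof (rule linearI)
  show "act u (v + w) = act u v + act u w" for v w
    by (induction u) (auto simp: refl_add)
  show "act u (c *\<^sub>R v) = c *\<^sub>R act u v" for c v
    by (induction u) (auto simp: refl_scale)
qed

lemmas act_add = linear_add[OF linear_act]
  and act_scale = linear_scale[OF linear_act]
  and act_diff = linear_diff[OF linear_act]
  and act_minus = linear_neg[OF linear_act]

lemma B_act: "B (act u v) (act u w) = B v w"
  by (induction u) (auto simp: B_refl)

lemma act_rev_self [simp]: "act (rev u) (act u v) = v"
  by (induction u arbitrary: v) auto

lemma act_self_rev [simp]: "act u (act (rev u) v) = v"
  using act_rev_self[of "rev u"] by simp

lemma B_act_left: "B (act u v) w = B v (act (rev u) w)"
  using B_act[of u v "act (rev u) w"] by simp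

text \<open>On the plane of two simple roots \<open>(s\<^sub>i s\<^sub>j)\<close> is a rotation by \<open>2\<pi>/k\<close>; this plane is
  nondegenerate for \<open>B\<close>, and its orthogonal complement is fixed.\<close>

lemma act_relator:
  assumes mij: "m i j = enat k"
  shows "act (concat (replicate k [i, j])) v = v"
proof (cases "i = j")
  case True
  then have "k = 1"
    using mij m_diag by simp
  then show ?thesis
    using True by simp
next
  case False
  then have k: "2 \<le> k"
    using m_offdiag mij by blast
  define t where "t = pi / real k"
  define c where "c = cos t"
  define x where "x = simple_root i"
  define y where "y = simple_root j"
  define P where "P l = act (concat (replicate l [i, j]))" for l
  have xy: "B x y = - c" "B y x = - c" "B x x = 1" "B y y = 1"
    using B_root_finite[OF mij] B_commute[of y x] by (simp_all add: x_def y_def c_def t_def)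
  have sin_pos: "0 < sin t"
    unfolding t_def using k by (intro sin_gt_zero) (auto simp: field_simps)
  have step: "P (Suc l) v = reflect i (reflect j (P l v))" for l v
    by (simp add: P_def)
  have comb: "reflect i (reflect j (p *\<^sub>R x + q *\<^sub>R y))
      = (2 * c * (2 * c * p - q) - p) *\<^sub>R x + (2 * c * p - q) *\<^sub>R y" for p q
    unfolding reflection_def x_def[symmetric] y_def[symmetric]
    by (simp add: B.add_right B.diff_right B.scaleR_right xy vec_eq_iff algebra_simps)
  have s1: "sin (a + t) = 2 * c * sin a - sin (a - t)" for a
    unfolding c_def by (rule sin_add_step)
  \<comment> \<open>The vectors \<open>sin a x + sin (a - t) y\<close> trace an ellipse, on which the product of the two reflections advances \<open>a\<close> by \<open>2 t\<close>.\<close>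
  have rot: "sin t *\<^sub>R P l v = sin (a + 2 * real l * t) *\<^sub>R x + sin (a + 2 * real l * t - t) *\<^sub>R y"
    if v: "sin t *\<^sub>R v = sin a *\<^sub>R x + sin (a - t) *\<^sub>R y" for l v a
  proof (induction l)
    case 0
    then show ?case
      using v by (simp add: P_def)
  next
    case (Suc l)
    let ?b = "a + 2 * real l * t"
    have "sin t *\<^sub>R P (Suc l) v = reflect i (reflect j (sin t *\<^sub>R P l v))"
      by (simp add: step refl_scale)
    also have "\<dots> = (2 * c * (2 * c * sin ?b - sin (?b - t)) - sin ?b) *\<^sub>R x
        + (2 * c * sin ?b - sin (?b - t)) *\<^sub>R y"
      by (simp add: Suc comb)
    also have "2 * c * sin ?b - sin (?b - t) = sin (?b + t)"
      by (simp add: s1)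
    also have "2 * c * sin (?b + t) - sin ?b = sin (?b + t + t)"
      by (simp only: s1[of "?b + t"] add_diff_cancel_right')
    also have "?b + t + t = a + 2 * real (Suc l) * t"
      by (simp add: algebra_simps)
    also have "?b + t = a + 2 * real (Suc l) * t - t"
      by (simp add: algebra_simps)
    finally show ?case .
  qed
  have "2 * real k * t = 2 * pi"
    using k by (simp add: t_def)
  then have "a + 2 * real k * t = a + 2 * pi" "a + 2 * real k * t - t = (a - t) + 2 * pi" for a
    by simp_all
  then have per: "sin (a + 2 * real k * t) = sin a" "sin (a + 2 * real k * t - t) = sin (a - t)" for a
    by (simp_all only: sin_periodic)
  have "sin t *\<^sub>R P k x = sin t *\<^sub>R x"
    using rot[of x t k] per[of t] by simp
  then have Px: "P k x = x"
    using sin_pos by simp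
  have "sin t *\<^sub>R (- y) = sin 0 *\<^sub>R x + sin (0 - t) *\<^sub>R y"
    by simp
  from rot[OF this, of k] have "sin t *\<^sub>R P k (- y) = sin t *\<^sub>R (- y)"
    using per[of 0] by simp
  then have "P k (- y) = - y"
    using sin_pos by (simp only: scaleR_cancel_left) simp
  then have Py: "P k y = y"
    unfolding P_def using act_minus[of _ y] by simp
  have c2: "1 - c\<^sup>2 \<noteq> 0"
    using sin_pos by (simp add: c_def flip: sin_squared_eq)
  define p where "p = (B x v + c * B y v) / (1 - c\<^sup>2)"
  define q where "q = (B y v + c * B x v) / (1 - c\<^sup>2)"
  define w where "w = v - p *\<^sub>R x - q *\<^sub>R y"
  have "p * (1 - c\<^sup>2) = B x v + c * B y v" "q * (1 - c\<^sup>2) = B y v + c * B x v"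
    using c2 by (simp_all add: p_def q_def)
  then have "(p - c * q) * (1 - c\<^sup>2) = B x v * (1 - c\<^sup>2)"
    "(q - c * p) * (1 - c\<^sup>2) = B y v * (1 - c\<^sup>2)"
    by algebra+
  then have "p - c * q = B x v" "q - c * p = B y v"
    using c2 by simp_all
  moreover have "B x w = B x v - (p - c * q)" "B y w = B y v - (q - c * p)"
    unfolding w_def by (simp_all add: B.diff_right B.scaleR_right xy)
  ultimately have "B x w = 0" "B y w = 0"
    by simp_all
  then have "reflect i w = w" "reflect j w = w"
    by (simp_all add: reflection_def x_def y_def)
  then have Pw: "P l w = w" for l
    by (induction l) (simp_all add: step, simp add: P_def)
  have "v = w + (p *\<^sub>R x + q *\<^sub>R y)"
    by (simp add: w_def)
  then have "P k v = P k w + (p *\<^sub>R P k x + q *\<^sub>R P k y)"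
    unfolding P_def by (simp only: act_add act_scale)
  also have "\<dots> = v"
    by (simp only: Px Py Pw) (simp add: w_def)
  finally show ?thesis
    by (simp add: P_def)
qed

lemma act_cong: "u \<asymp> v \<Longrightarrow> act u = act v"
proof (induction rule: coxeter_cong.induct)
  case (relator i j k u v)
  show ?case
    by (rule ext) (simp add: act_relator[OF relator])
qed auto

text \<open>A reduced word in two letters alternates, so its action on a simple root is given by
  Chebyshev polynomials; that the word is no longer than \<open>m i t\<close> makes their values nonnegative.\<close>

lemma dihedral_root:
  assumes "i \<noteq> t" "set y \<subseteq> {i, t}" "reduced (y @ [i])"
  shows "\<exists>a b. 0 \<le> a \<and> 0 \<le> b \<and> act y (simple_root i) = a *\<^sub>R simple_root i + b *\<^sub>R simple_root t"
proof -
  define c where "c = - B (simple_root i) (simple_root t)"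
  \<comment> \<open>Here \<open>f\<close> is the first letter of \<open>y @ [i]\<close> and \<open>g\<close> the other one of the two letters.\<close>
  have main: "\<exists>f g. {f, g} = {i, t} \<and> y @ [i] = alternating_word f g (Suc (length y)) \<and>
      act y (simple_root i) = chebyshev c (Suc (length y)) *\<^sub>R simple_root f
        + chebyshev c (length y) *\<^sub>R simple_root g"
    using assms(2,3)
  proof (induction y)
    case Nil
    then show ?case
      by (intro exI[of _ i] exI[of _ t]) simp
  next
    case (Cons x y)
    have "reduced (y @ [i])"
      using Cons.prems(2) reduced_appendD2[of "[x]" "y @ [i]"] by simp
    then obtain f g where fg: "{f, g} = {i, t}" "y @ [i] = alternating_word f g (Suc (length y))"
      and a: "act y (simple_root i) = chebyshev c (Suc (length y)) *\<^sub>R simple_root f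
        + chebyshev c (length y) *\<^sub>R simple_root g"
      using Cons by auto
    have "x \<noteq> f"
    proof
      assume "x = f"
      then have "(x # y) @ [i] = [] @ [x, x] @ alternating_word g f (length y)"
        using fg(2) by simp
      then show False
        using Cons.prems(2) not_reduced_square by metis
    qed
    then have x: "x = g"
      using Cons.prems(1) fg(1) by (auto simp: doubleton_eq_iff)
    have Bfg: "B (simple_root g) (simple_root f) = - c"
      using fg(1) B_commute[of "simple_root i"] by (auto simp: c_def doubleton_eq_iff)
    have "act (x # y) (simple_root i)
        = chebyshev c (Suc (Suc (length y))) *\<^sub>R simple_root g
        + chebyshev c (Suc (length y)) *\<^sub>R simple_root f"
      by (simp add: x a reflection_def B.add_right B.scaleR_right Bfg vec_eq_iff algebra_simps)
    moreover have "(x # y) @ [i] = alternating_word g f (Suc (length (x # y)))"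
      using fg(2) x by simp
    ultimately show ?case
      using fg(1) by (intro exI[of _ g] exI[of _ f]) (simp add: insert_commute)
  qed
  then obtain f g where fg: "{f, g} = {i, t}" "y @ [i] = alternating_word f g (Suc (length y))"
    and a: "act y (simple_root i) = chebyshev c (Suc (length y)) *\<^sub>R simple_root f
        + chebyshev c (length y) *\<^sub>R simple_root g"
    by blast
  have fg_cases: "f = i \<and> g = t \<or> f = t \<and> g = i"
    using fg(1) by (simp add: doubleton_eq_iff)
  then have mfg: "m f g = m i t"
    using m_sym[of t i] by auto
  have "0 \<le> chebyshev c (Suc (length y)) \<and> 0 \<le> chebyshev c (length y)"
  proof (cases "m i t")
    case (enat k)
    then have "2 \<le> k"
      using m_offdiag assms(1) by blast
    moreover have "Suc (length y) \<le> k"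
      using reduced_alternating_bound[of f g] assms(3) fg(2) mfg enat \<open>2 \<le> k\<close> by simp
    ultimately show ?thesis
      using chebyshev_nonneg_finite[of k] B_root_finite[OF enat] by (simp add: c_def)
  next
    case infinity
    then show ?thesis
      using chebyshev_mono[of c "length y"] B_root_infinite[OF infinity] by (simp add: c_def)
  qed
  then show ?thesis
    using fg_cases a by (metis add.commute)
qed

text \<open>Humphreys, Reflection Groups and Coxeter Groups, Section 5.4: peel off a maximal suffix in the
  two letters \<open>i\<close> and \<open>t\<close>, where \<open>t\<close> is the last letter of the word. By maximality the remaining
  prefix stays reduced after appending \<open>i\<close> or \<open>t\<close>, so induction applies to it, and the suffix maps
  the simple root to a nonnegative combination of two simple roots.\<close>

theorem reduced_root_nonneg:
  assumes "reduced (u @ [i])"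
  shows "0 \<le> act u (simple_root i) $ j"
  using assms
proof (induction "length u" arbitrary: u i j rule: less_induct)
  case less
  show ?case
  proof (cases u rule: rev_cases)
    case Nil
    then show ?thesis
      by (simp add: axis_def)
  next
    case (snoc u0 t)
    have it: "i \<noteq> t"
      using less.prems snoc not_reduced_square[of u0 i "[]"] by auto
    have red_u: "reduced u"
      using less.prems reduced_appendD1 by blast
    define Q where "Q v \<longleftrightarrow> (\<exists>y. set y \<subseteq> {i, t} \<and> u \<asymp> v @ y \<and> length v + length y = length u)" for v
    have "Q u0"
      unfolding Q_def using snoc by (intro exI[of _ "[t]"]) (auto intro: coxeter_cong.refl)
    then obtain v where "Q v" and v_min: "\<And>w. Q w \<Longrightarrow> length v \<le> length w"
      using ex_has_least_nat[of Q u0 length] by blast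
    then obtain y where y: "set y \<subseteq> {i, t}" "u \<asymp> v @ y" "length v + length y = length u"
      unfolding Q_def by blast
    have shorter: "length v < length u"
      using v_min[OF \<open>Q u0\<close>] snoc by simp
    have "reduced (v @ y)"
      using reduced_cong[OF red_u y(2)] y(3) by simp
    then have "reduced v"
      by (rule reduced_appendD1)
    \<comment> \<open>Otherwise \<open>v\<close> could end in \<open>x\<close>, and this letter could be moved to the suffix.\<close>
    have ext: "reduced (v @ [x])" if x: "x \<in> {i, t}" for x
    proof (rule ccontr)
      assume "\<not> reduced (v @ [x])"
      then obtain v' where v': "v \<asymp> v' @ [x]" "length v = Suc (length v')"
        using not_reduced_snoc \<open>reduced v\<close> by blast
      have "u \<asymp> v' @ (x # y)"
        using coxeter_cong.trans[OF y(2) cong_append[OF v'(1) coxeter_cong.refl]] by simp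
      then have "Q v'"
        unfolding Q_def using x y v'(2) by (intro exI[of _ "x # y"]) auto
      then show False
        using v_min[of v'] v'(2) by simp
    qed
    have "u @ [i] \<asymp> v @ (y @ [i])"
      using cong_append[OF y(2) coxeter_cong.refl] by simp
    then have "reduced (v @ (y @ [i]))"
      using reduced_cong[OF less.prems] y(3) by simp
    then have "reduced (y @ [i])"
      by (rule reduced_appendD2)
    then obtain a b where ab: "0 \<le> a" "0 \<le> b"
      "act y (simple_root i) = a *\<^sub>R simple_root i + b *\<^sub>R simple_root t"
      using dihedral_root[OF it y(1)] by blast
    have "act u (simple_root i) = a *\<^sub>R act v (simple_root i) + b *\<^sub>R act v (simple_root t)"
      by (simp add: act_cong[OF y(2)] ab(3) act_add act_scale)
    moreover have "0 \<le> act v (simple_root i) $ j" "0 \<le> act v (simple_root t) $ j"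
      by (rule less.hyps[OF shorter ext]; simp)+
    ultimately show ?thesis
      using ab by simp
  qed
qed

end


section \<open>Symmetric matrices of signature \<open>(n - 1, 1)\<close>\<close>

lemma symmetric_matrix_inner:
  fixes A :: "real ^ 'n ^ 'n"
  assumes "transpose A = A"
  shows "x \<bullet> (A *v y) = (A *v x) \<bullet> y"
  using assms by (metis dot_lmul_matrix transpose_matrix_vector)

lemma quadratic_form_sum:
  fixes A :: "real ^ 'n ^ 'n"
  shows "x \<bullet> (A *v x) = (\<Sum>i\<in>UNIV. \<Sum>j\<in>UNIV. A $ i $ j * (x $ i * x $ j))"
  by (simp add: inner_vec_def matrix_vector_mult_def sum_distrib_left algebra_simps)

text \<open>First-order condition for a minimum of the Rayleigh quotient: otherwise moving from \<open>v\<close>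
  along \<open>- (A v - c v)\<close> would lower it.\<close>

lemma rayleigh_minimizer_eigenvector:
  fixes A :: "real ^ 'n ^ 'n"
  assumes sym: "transpose A = A" and S: "subspace S" "\<And>x. x \<in> S \<Longrightarrow> A *v x \<in> S"
    and low: "\<And>x. x \<in> S \<Longrightarrow> c * (x \<bullet> x) \<le> x \<bullet> (A *v x)"
    and v: "v \<in> S" "v \<bullet> (A *v v) = c * (v \<bullet> v)"
  shows "A *v v = c *\<^sub>R v"
proof -
  define r where "r = A *v v - c *\<^sub>R v"
  define R where "R = r \<bullet> r"
  define K where "K = r \<bullet> (A *v r) - c * R"
  have rS: "r \<in> S"
    unfolding r_def using S v(1) by (intro subspace_diff subspace_scale) auto
  have K: "0 \<le> K"
    using low[OF rS] by (simp add: K_def R_def)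
  have expand: "0 \<le> 2 * t * R + t\<^sup>2 * K" for t
  proof -
    let ?x = "v + t *\<^sub>R r"
    have "?x \<in> S"
      using S v(1) rS by (intro subspace_add subspace_scale) auto
    from low[OF this] have "0 \<le> ?x \<bullet> (A *v ?x) - c * (?x \<bullet> ?x)"
      by linarith
    also have "?x \<bullet> (A *v ?x) - c * (?x \<bullet> ?x)
        = v \<bullet> (A *v v) + t * (v \<bullet> (A *v r)) + t * (r \<bullet> (A *v v)) + t\<^sup>2 * (r \<bullet> (A *v r))
          - c * (v \<bullet> v + 2 * t * (r \<bullet> v) + t\<^sup>2 * R)"
      by (simp add: R_def matrix_vector_right_distrib matrix_vector_mult_scaleR inner_add_left
          inner_add_right inner_commute[of v r] power2_eq_square algebra_simps)
    also have "v \<bullet> (A *v r) = r \<bullet> (A *v v)"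
      using symmetric_matrix_inner[OF sym, of v r] by (simp add: inner_commute)
    also have "r \<bullet> (A *v v) = R + c * (r \<bullet> v)"
      by (simp add: R_def r_def inner_diff_right inner_diff_left algebra_simps)
    finally show ?thesis
      using v(2) by (simp add: K_def algebra_simps)
  qed
  have "R = 0"
  proof (rule ccontr)
    assume "R \<noteq> 0"
    then have "0 < R"
      by (simp add: R_def)
    \<comment> \<open>The minimum of the quadratic is at \<open>- R / K\<close>; adding one avoids the case \<open>K = 0\<close>.\<close>
    define t where "t = - R / (K + 1)"
    have "t * (K + 1) = - R"
      using K by (simp add: t_def)
    then have "2 * t * R + t\<^sup>2 * K = t * R - t\<^sup>2"
      by algebra
    moreover have "t < 0"
      using \<open>0 < R\<close> K by (simp add: t_def field_simps)
    then have "t * R < 0" "0 < t\<^sup>2"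
      using \<open>0 < R\<close> by (simp_all add: mult_neg_pos)
    ultimately show False
      using expand[of t] by linarith
  qed
  then show ?thesis
    by (simp add: R_def r_def)
qed

lemma minimal_eigenvector:
  fixes A :: "real ^ 'n ^ 'n"
  assumes sym: "transpose A = A" and S: "subspace S" "\<And>x. x \<in> S \<Longrightarrow> A *v x \<in> S"
    and "S \<noteq> {0}"
  obtains c v where "v \<in> S" "norm v = 1" "A *v v = c *\<^sub>R v"
    "\<And>x. x \<in> S \<Longrightarrow> c * (x \<bullet> x) \<le> x \<bullet> (A *v x)"
proof -
  let ?K = "sphere 0 1 \<inter> S"
  obtain z where z: "z \<in> S" "z \<noteq> 0"
    using assms(4) S(1) subspace_0 by blast
  have "z /\<^sub>R norm z \<in> ?K"
    using z S(1) by (auto intro: subspace_scale)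
  moreover have "compact ?K"
    using closed_subspace[OF S(1)] by (intro compact_Int_closed) auto
  moreover have "continuous_on ?K (\<lambda>x. x \<bullet> (A *v x))"
    by (intro continuous_on_inner continuous_on_id matrix_vector_mult_linear_continuous_on)
  ultimately obtain v where v: "v \<in> ?K" "\<And>x. x \<in> ?K \<Longrightarrow> v \<bullet> (A *v v) \<le> x \<bullet> (A *v x)"
    using continuous_attains_inf[of ?K "\<lambda>x. x \<bullet> (A *v x)"] by blast
  define c where "c = v \<bullet> (A *v v)"
  have low: "c * (x \<bullet> x) \<le> x \<bullet> (A *v x)" if "x \<in> S" for x
  proof (cases "x = 0")
    case False
    then have "x /\<^sub>R norm x \<in> ?K"
      using that S(1) by (auto intro: subspace_scale)
    from v(2)[OF this] have "c \<le> (x \<bullet> (A *v x)) / (norm x)\<^sup>2"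
      by (simp add: c_def matrix_vector_mult_scaleR power2_eq_square divide_inverse mult_ac)
    then show ?thesis
      using False by (simp add: field_simps power2_norm_eq_inner)
  qed simp
  have nv: "norm v = 1"
    using v(1) by simp
  then have "v \<bullet> v = 1"
    by (simp add: norm_eq_1)
  then have "A *v v = c *\<^sub>R v"
    using rayleigh_minimizer_eigenvector[OF sym S low, of v] v(1) by (simp add: c_def)
  then show ?thesis
    using that v(1) nv low by blast
qed

text \<open>Perron-Frobenius: replacing the coordinates of a minimizer of the Rayleigh quotient by their
  absolute values does not increase it when the off-diagonal entries are nonpositive, and a zero
  coordinate of a nonnegative eigenvector would split the matrix into blocks.\<close>

lemma perron_frobenius_minimal:
  fixes A :: "real ^ 'n ^ 'n"
  assumes sym: "transpose A = A" and off: "\<And>i j. i \<noteq> j \<Longrightarrow> A $ i $ j \<le> 0"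
    and irr: "irreducible_matrix A"
  shows "\<exists>c u. norm u = 1 \<and> A *v u = c *\<^sub>R u \<and> (\<forall>i. 0 < u $ i)
    \<and> (\<forall>x. c * (x \<bullet> x) \<le> x \<bullet> (A *v x))"
proof -
  have "(UNIV :: (real ^ 'n) set) \<noteq> {0}"
  proof
    assume "(UNIV :: (real ^ 'n) set) = {0}"
    then have "(axis undefined 1 :: real ^ 'n) = 0"
      by blast
    then show False
      by (simp add: axis_eq_0_iff)
  qed
  then obtain c v where v: "norm v = 1" "A *v v = c *\<^sub>R v"
    and low: "\<And>x. c * (x \<bullet> x) \<le> x \<bullet> (A *v x)"
    using minimal_eigenvector[OF sym subspace_UNIV UNIV_I] UNIV_I by metis
  define u where "u = (\<chi> i. \<bar>v $ i\<bar>)"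
  have uu: "u \<bullet> u = v \<bullet> v"
    by (simp add: u_def inner_vec_def)
  then have nu: "norm u = 1"
    using v(1) by (simp add: norm_eq_sqrt_inner)
  have "A $ i $ j * (u $ i * u $ j) \<le> A $ i $ j * (v $ i * v $ j)" for i j
  proof (cases "i = j")
    case False
    have "v $ i * v $ j \<le> u $ i * u $ j"
      by (simp add: u_def flip: abs_mult)
    then show ?thesis
      using off[OF False] by (rule mult_left_mono_neg)
  qed (simp add: u_def)
  then have "u \<bullet> (A *v u) \<le> v \<bullet> (A *v v)"
    unfolding quadratic_form_sum by (intro sum_mono)
  also have "\<dots> = c * (u \<bullet> u)"
    by (simp add: v(2) uu)
  finally have "u \<bullet> (A *v u) = c * (u \<bullet> u)"
    using low[of u] by linarith
  then have Au: "A *v u = c *\<^sub>R u"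
    using rayleigh_minimizer_eigenvector[OF sym, of UNIV c u] low by auto
  have nonneg: "0 \<le> u $ i" for i
    by (simp add: u_def)
  define I where "I = {i. u $ i = 0}"
  have "I = {}"
  proof (rule ccontr)
    assume "I \<noteq> {}"
    moreover have "I \<noteq> UNIV"
    proof
      assume "I = UNIV"
      then have "u = 0"
        by (auto simp: I_def vec_eq_iff)
      then show False
        using nu by simp
    qed
    moreover have "A $ i $ j = 0 \<and> A $ j $ i = 0" if "i \<in> I" "j \<in> - I" for i j
    proof -
      have "(\<Sum>j\<in>UNIV. A $ i $ j * u $ j) = (A *v u) $ i"
        by (simp add: matrix_vector_mult_def)
      also have "\<dots> = 0"
        using that(1) by (simp add: Au I_def)
      finally have "(\<Sum>j\<in>UNIV. - (A $ i $ j * u $ j)) = 0"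
        by (simp add: sum_negf)
      moreover have "0 \<le> - (A $ i $ k * u $ k)" for k
      proof (cases "k = i")
        case True
        then show ?thesis
          using that(1) by (simp add: I_def)
      next
        case False
        then show ?thesis
          using off[of i k] nonneg[of k] by (simp add: mult_nonpos_nonneg)
      qed
      ultimately have "- (A $ i $ j * u $ j) = 0"
        by (subst (asm) sum_nonneg_eq_0_iff) auto
      then have "A $ i $ j = 0"
        using that(2) by (simp add: I_def)
      moreover have "A $ j $ i = A $ i $ j"
        using arg_cong[OF sym, of "\<lambda>M. M $ j $ i"] by (simp add: transpose_def)
      ultimately show ?thesis
        by simp
    qed
    ultimately show False
      using irr unfolding irreducible_matrix_def by blast
  qed
  then have "0 < u $ i" for i
    using nonneg[of i] by (force simp: I_def less_le)
  then show ?thesis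
    using nu Au low by blast
qed

lemma subspace_eigenspace: "subspace (eigenspace A c)"
  by (auto simp: subspace_def eigenspace_def matrix_vector_right_distrib
      matrix_vector_mult_scaleR algebra_simps)

lemma eigenspace_orthogonal:
  fixes A :: "real ^ 'n ^ 'n"
  assumes "transpose A = A" "x \<in> eigenspace A c" "y \<in> eigenspace A d" "c \<noteq> d"
  shows "x \<bullet> y = 0"
proof -
  have "d * (x \<bullet> y) = c * (x \<bullet> y)"
    using symmetric_matrix_inner[OF assms(1), of x y] assms(2,3) by (simp add: eigenspace_def)
  then show ?thesis
    using assms(4) by simp
qed

text \<open>Orthonormal bases of different eigenspaces together form an orthonormal set.\<close>

lemma sum_dim_eigenspace_le:
  fixes A :: "real ^ 'n ^ 'n"
  assumes sym: "transpose A = A" and F: "finite F"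
  shows "(\<Sum>c\<in>F. dim (eigenspace A c)) \<le> CARD('n)"
proof -
  have "\<forall>c. \<exists>b. b \<subseteq> eigenspace A c \<and> pairwise orthogonal b \<and> (\<forall>x\<in>b. norm x = 1)
      \<and> independent b \<and> card b = dim (eigenspace A c)"
    by (rule allI, rule orthonormal_basis_subspace[OF subspace_eigenspace]) blast
  then obtain b where "\<forall>c. b c \<subseteq> eigenspace A c \<and> pairwise orthogonal (b c) \<and> (\<forall>x\<in>b c. norm x = 1)
      \<and> independent (b c) \<and> card (b c) = dim (eigenspace A c)"
    by (rule choice[THEN exE])
  then have b: "\<And>c. b c \<subseteq> eigenspace A c" "\<And>c. pairwise orthogonal (b c)"
    "\<And>c x. x \<in> b c \<Longrightarrow> norm x = 1" "\<And>c. independent (b c)"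
    "\<And>c. card (b c) = dim (eigenspace A c)"
    by simp_all
  have orth: "x \<bullet> y = 0" if "x \<in> b c" "y \<in> b d" "c \<noteq> d" for x y c d
    using eigenspace_orthogonal[OF sym subsetD[OF b(1)] subsetD[OF b(1)] that(3)] that(1,2) by simp
  have "pairwise orthogonal (\<Union>c\<in>F. b c)"
    unfolding pairwise_def
  proof safe
    fix x y c d assume "x \<in> b c" "y \<in> b d" "x \<noteq> y"
    then show "orthogonal x y"
      using orth[of x c y d] b(2)[of c] by (cases "c = d") (auto simp: pairwise_def orthogonal_def)
  qed
  moreover have "0 \<notin> (\<Union>c\<in>F. b c)"
    using b(3) by fastforce
  ultimately have "independent (\<Union>c\<in>F. b c)"
    by (rule pairwise_orthogonal_independent)
  then have "card (\<Union>c\<in>F. b c) \<le> CARD('n)"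
    using independent_bound by force
  moreover have "card (\<Union>c\<in>F. b c) = (\<Sum>c\<in>F. card (b c))"
  proof (rule card_UN_disjoint[OF F])
    show "\<forall>c\<in>F. finite (b c)"
      using b(4) independent_bound by blast
    show "\<forall>c\<in>F. \<forall>d\<in>F. c \<noteq> d \<longrightarrow> b c \<inter> b d = {}"
    proof (intro ballI impI)
      fix c d :: real assume "c \<noteq> d"
      show "b c \<inter> b d = {}"
      proof (rule ccontr)
        assume "b c \<inter> b d \<noteq> {}"
        then obtain x where "x \<in> b c" "x \<in> b d"
          by blast
        then have "x \<bullet> x = 0" "norm x = 1"
          using orth \<open>c \<noteq> d\<close> b(3) by blast+
        then show False
          by simp
      qed
    qed
  qed
  ultimately show ?thesis
    by (simp add: b(5))
qed

lemma dim_eigenspace_pos: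
  "v \<in> eigenspace A c \<Longrightarrow> v \<noteq> 0 \<Longrightarrow> 0 < dim (eigenspace A c)"
  using dim_eq_0[of "eigenspace A c"] by (metis gr0I singletonD subsetD)

text \<open>With only one negative eigenvalue counted with multiplicity, and the eigenvalue zero excluded
  by the number of positive ones, the minimum of the quadratic form on the unit sphere of the
  orthogonal complement of the Perron-Frobenius vector is positive.\<close>

theorem lorentzian_matrix:
  fixes A :: "real ^ 'n ^ 'n"
  assumes sym: "transpose A = A" and off: "\<And>i j. i \<noteq> j \<Longrightarrow> A $ i $ j \<le> 0"
    and irr: "irreducible_matrix A" and sig: "matrix_signature A = (CARD('n) - 1, 1)"
  shows "\<exists>l mu u. 0 < l \<and> 0 < mu \<and> norm u = 1 \<and> A *v u = (- l) *\<^sub>R u \<and> (\<forall>i. 0 < u $ i)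
    \<and> (\<forall>x. u \<bullet> x = 0 \<longrightarrow> mu * (x \<bullet> x) \<le> x \<bullet> (A *v x))
    \<and> (\<forall>c v. c < 0 \<longrightarrow> v \<in> eigenspace A c \<longrightarrow> norm v = 1 \<longrightarrow> (\<forall>i. 0 < v $ i) \<longrightarrow> v = u)"
proof -
  let ?N = "{c \<in> eigenvalues A. c < 0}"
  let ?P = "{c \<in> eigenvalues A. 0 < c}"
  have sumN: "(\<Sum>c\<in>?N. dim (eigenspace A c)) = 1"
    and sumP: "(\<Sum>c\<in>?P. dim (eigenspace A c)) = CARD('n) - 1"
    using sig by (simp_all add: matrix_signature_def)
  have finN: "finite ?N"
    by (rule ccontr) (use sumN in simp)
  have N_eq: "c = d \<and> dim (eigenspace A c) = 1" if "c \<in> ?N" "d \<in> ?N" for c d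
  proof -
    have pos: "0 < dim (eigenspace A e)" if "e \<in> ?N" for e
      using that dim_eigenspace_pos[of _ A e] by (auto simp: eigenvalues_def)
    have "(\<Sum>e\<in>{c, d}. dim (eigenspace A e)) \<le> (\<Sum>c\<in>?N. dim (eigenspace A c))"
      using finN that by (intro sum_mono2) auto
    then show ?thesis
      using pos[OF that(1)] pos[OF that(2)] sumN by (cases "c = d") auto
  qed
  obtain k u where nu: "norm u = 1" and Au: "A *v u = k *\<^sub>R u" and u_pos: "\<And>i. 0 < u $ i"
    and low: "\<And>x. k * (x \<bullet> x) \<le> x \<bullet> (A *v x)"
    using perron_frobenius_minimal[OF sym off irr] by blast
  have uu: "u \<bullet> u = 1" "u \<noteq> 0"
    using nu by (auto simp: norm_eq_1)
  have "?N \<noteq> {}"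
    using sumN by force
  then obtain d w where "d < 0" "w \<noteq> 0" "A *v w = d *\<^sub>R w"
    by (auto simp: eigenvalues_def eigenspace_def)
  then have "k * (w \<bullet> w) \<le> d * (w \<bullet> w)" "0 < w \<bullet> w"
    using low[of w] by simp_all
  then have "k < 0"
    using \<open>d < 0\<close> by (simp add: mult_le_cancel_right)
  have u_eig: "u \<in> eigenspace A k"
    using Au by (simp add: eigenspace_def)
  then have kN: "k \<in> ?N"
    using uu \<open>k < 0\<close> by (auto simp: eigenvalues_def)
  have unique_span: "v \<in> span {u}" if "v \<in> eigenspace A k" for v
  proof (rule ccontr)
    assume "v \<notin> span {u}"
    then have "independent {v, u}"
      using uu by (subst independent_insert) auto
    moreover have "v \<noteq> u"
      using \<open>v \<notin> span {u}\<close> span_base by blast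
    ultimately have "2 \<le> dim (eigenspace A k)"
      using independent_card_le_dim[of "{v, u}" "eigenspace A k"] that u_eig by simp
    then show False
      using N_eq[OF kN kN] by simp
  qed
  let ?S = "{x. u \<bullet> x = 0}"
  have S: "subspace ?S" "A *v x \<in> ?S" if "x \<in> ?S" for x
  proof -
    show "subspace ?S"
      using subspace_orthogonal_to_vector[of u] by (simp add: orthogonal_def)
    show "A *v x \<in> ?S"
      using that symmetric_matrix_inner[OF sym, of u x] Au by simp
  qed
  have "\<exists>mu>0. \<forall>x\<in>?S. mu * (x \<bullet> x) \<le> x \<bullet> (A *v x)"
  proof (cases "?S = {0}")
    case True
    then show ?thesis
      by (intro exI[of _ 1]) auto
  next
    case False
    have "subspace ?S"
      using S(1)[of 0] by simp
    have "\<exists>c v. v \<in> ?S \<and> norm v = 1 \<and> A *v v = c *\<^sub>R v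
        \<and> (\<forall>x\<in>?S. c * (x \<bullet> x) \<le> x \<bullet> (A *v x))"
      by (rule minimal_eigenvector[OF sym \<open>subspace ?S\<close> S(2) False]) blast+
    then obtain c v where v: "v \<in> ?S" "norm v = 1" "A *v v = c *\<^sub>R v"
      and lowS: "\<And>x. x \<in> ?S \<Longrightarrow> c * (x \<bullet> x) \<le> x \<bullet> (A *v x)"
      by blast
    have "v \<noteq> 0"
      using v(2) by auto
    have v_eig: "v \<in> eigenspace A c"
      using v(3) by (simp add: eigenspace_def)
    then have c_eig: "c \<in> eigenvalues A"
      using \<open>v \<noteq> 0\<close> by (auto simp: eigenvalues_def)
    have "0 < c"
    proof (rule ccontr)
      assume "\<not> 0 < c"
      then consider "c < 0" | "c = 0"
        by linarith
      then show False
      proof cases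
        case 1
        then have "c = k"
          using N_eq[of c k] kN c_eig by blast
        then have "v \<in> span {u}"
          using unique_span v_eig by blast
        then obtain t where "v = t *\<^sub>R u"
          by (auto simp: span_singleton)
        then show False
          using v(1) \<open>v \<noteq> 0\<close> uu by simp
      next
        case 2
        have finP: "finite ?P \<or> CARD('n) = 1"
          using sumP zero_less_card_finite[where 'a = 'n] by (cases "finite ?P") (simp_all add: le_Suc_eq)
        \<comment> \<open>A sum over an infinite set is zero by convention, which could equal \<open>n - 1\<close> only for \<open>n = 1\<close>.\<close>
        define F where "F = (if finite ?P then ?P else {})"
        have F: "finite F" "(\<Sum>c\<in>F. dim (eigenspace A c)) = CARD('n) - 1" "\<And>c. c \<in> F \<Longrightarrow> 0 < c"
          using finP sumP by (auto simp: F_def split: if_splits)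
        have "(\<Sum>c\<in>F \<union> {k, 0}. dim (eigenspace A c))
            = (\<Sum>c\<in>F. dim (eigenspace A c)) + (\<Sum>c\<in>{k, 0}. dim (eigenspace A c))"
          using F \<open>k < 0\<close> by (intro sum.union_disjoint) fastforce+
        also have "\<dots> = CARD('n) - 1 + (1 + dim (eigenspace A 0))"
          using F(2) N_eq[OF kN kN] \<open>k < 0\<close> by simp
        finally have "CARD('n) - 1 + (1 + dim (eigenspace A 0)) \<le> CARD('n)"
          using sum_dim_eigenspace_le[OF sym, of "F \<union> {k, 0}"] F(1) by simp
        moreover have "0 < dim (eigenspace A 0)"
          using dim_eigenspace_pos v_eig \<open>v \<noteq> 0\<close> 2 by blast
        ultimately show False
          using zero_less_card_finite[where 'a = 'n] by linarith
      qed
    qed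
    then show ?thesis
      using lowS by blast
  qed
  then obtain mu where mu: "0 < mu" "\<And>x. u \<bullet> x = 0 \<Longrightarrow> mu * (x \<bullet> x) \<le> x \<bullet> (A *v x)"
    by blast
  have unique: "v = u" if v: "c < 0" "v \<in> eigenspace A c" "norm v = 1" "\<And>i. 0 < v $ i" for c v
  proof -
    have "v \<noteq> 0"
      using v(3) by auto
    then have "c \<in> ?N"
      using v(1,2) by (auto simp: eigenvalues_def)
    then have "c = k"
      using N_eq kN by blast
    then obtain t where t: "v = t *\<^sub>R u"
      using unique_span v(2) by (auto simp: span_singleton)
    then have "\<bar>t\<bar> = 1"
      using v(3) nu by simp
    moreover have "0 < t"
      using v(4)[of undefined] u_pos[of undefined] t by (simp add: zero_less_mult_iff)
    ultimately show "v = u"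
      using t by simp
  qed
  have "0 < - k" "A *v u = (- (- k)) *\<^sub>R u"
    using \<open>k < 0\<close> Au by simp_all
  then show ?thesis
    using mu nu u_pos unique by blast
qed

lemma gram_component [simp]: "gram B $ i $ j = B (simple_root i) (simple_root j)"
  by (simp add: gram_def)

lemma bilinear_gram:
  assumes "bilinear B"
  shows "B x y = x \<bullet> (gram B *v y)"
proof -
  have "B x y = B (\<Sum>i\<in>UNIV. x $ i *\<^sub>R simple_root i) (\<Sum>j\<in>UNIV. y $ j *\<^sub>R simple_root j)"
    using basis_expansion[of x] basis_expansion[of y] by (simp add: scalar_mult_eq_scaleR)
  also have "\<dots> = (\<Sum>i\<in>UNIV. \<Sum>j\<in>UNIV. B (x $ i *\<^sub>R simple_root i) (y $ j *\<^sub>R simple_root j))"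
    by (simp only: bilinear_sum[OF assms] sum.cartesian_product)
  also have "\<dots> = x \<bullet> (gram B *v y)"
    by (simp add: inner_vec_def matrix_vector_mult_def sum_distrib_left bilinear_lmul[OF assms]
        bilinear_rmul[OF assms] mult_ac)
  finally show ?thesis .
qed


section \<open>Combinatorics of lengths and reflections\<close>

context coxeter_words
begin

text \<open>The length of the group element that a word represents.\<close>

definition len :: "'n list \<Rightarrow> nat" where
  "len u = (LEAST k. \<exists>v. length v = k \<and> u \<asymp> v)"

lemma len_reduced:
  assumes "u \<asymp> v" "reduced v"
  shows "len u = length v"
  unfolding len_def
proof (rule Least_equality)
  show "\<exists>w. length w = length v \<and> u \<asymp> w"
    using assms by blast
  fix k assume "\<exists>w. length w = k \<and> u \<asymp> w"
  then show "length v \<le> k"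
    using assms reducedD coxeter_cong.sym coxeter_cong.trans by metis
qed

lemma ex_reduced_len: "\<exists>v. u \<asymp> v \<and> reduced v \<and> length v = len u"
  using ex_reduced[of u] len_reduced[of u] by auto

lemma len_le:
  assumes "u \<asymp> v"
  shows "len u \<le> length v"
  unfolding len_def using assms by (intro Least_le) auto

lemma len_cong:
  assumes "u \<asymp> v"
  shows "len u = len v"
  using ex_reduced_len[of v] assms len_reduced[of u] coxeter_cong.trans by metis

lemma len_append: "len (u @ v) \<le> len u + len v"
proof -
  obtain u' v' where uv: "u \<asymp> u'" "length u' = len u" "v \<asymp> v'" "length v' = len v"
    using ex_reduced_len by metis
  then have "u @ v \<asymp> u' @ v'"
    by (intro cong_append)
  then show ?thesis
    using len_le uv by fastforce
qed

lemma cong_cancel_left: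
  assumes "rev u @ v \<asymp> w"
  shows "u @ w \<asymp> v"
proof -
  have "u @ w \<asymp> u @ (rev u @ v)"
    using assms by (intro cong_append coxeter_cong.refl) (rule coxeter_cong.sym)
  moreover have "(u @ rev u) @ v \<asymp> [] @ v"
    by (intro cong_append coxeter_cong.refl cong_self_rev)
  ultimately show ?thesis
    using coxeter_cong.trans by fastforce
qed

text \<open>The word of the reflection \<open>s\<^sub>1 \<dots> s\<^sub>k s\<^sub>k\<^sub>+\<^sub>1 s\<^sub>k \<dots> s\<^sub>1\<close>, a conjugate of the letter at position \<open>k\<close>
  counted from zero; left multiplication by it deletes that letter.\<close>

definition reflection_word :: "'n list \<Rightarrow> nat \<Rightarrow> 'n list" where
  "reflection_word u k = take k u @ [u ! k] @ rev (take k u)"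

lemma reflection_word_delete:
  assumes "k < length u"
  shows "reflection_word u k @ u \<asymp> take k u @ drop (Suc k) u"
proof -
  let ?p = "take k u" and ?q = "drop (Suc k) u"
  have u: "u = ?p @ [u ! k] @ ?q"
    using id_take_nth_drop[OF assms] by simp
  have "reflection_word u k @ u = (?p @ [u ! k]) @ (rev ?p @ ?p) @ ([u ! k] @ ?q)"
    by (subst (2) u) (simp add: reflection_word_def)
  also have "\<dots> \<asymp> (?p @ [u ! k]) @ [] @ ([u ! k] @ ?q)"
    by (intro cong_context cong_rev_self)
  finally have "reflection_word u k @ u \<asymp> ?p @ [u ! k, u ! k] @ ?q"
    by simp
  then show ?thesis
    using cong_square[of ?p "u ! k" ?q] by (rule coxeter_cong.trans)
qed

lemma reflection_word_square: "reflection_word u k @ reflection_word u k \<asymp> []"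
  using cong_self_rev[of "reflection_word u k"] by (simp add: reflection_word_def)

text \<open>Two equal reflections would cancel, whereas applying them to the word deletes two letters.\<close>

lemma reflection_words_distinct:
  assumes "reduced u" "j < l" "l < length u"
  shows "\<not> reflection_word u j \<asymp> reflection_word u l"
proof
  assume eq: "reflection_word u j \<asymp> reflection_word u l"
  let ?r = "reflection_word u j"
  define v where "v = take l u @ drop (Suc l) u"
  have v: "length v = length u - 1" "take j v = take j u" "v ! j = u ! j" "j < length v"
    using assms by (auto simp: v_def nth_append)
  then have rv: "reflection_word v j = ?r"
    by (simp add: reflection_word_def)
  have "u \<asymp> (?r @ ?r) @ u"
    using cong_append[OF reflection_word_square coxeter_cong.refl, of u j u] coxeter_cong.sym
    by fastforce
  also have "(?r @ ?r) @ u = ?r @ (?r @ u)"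
    by simp
  finally have 1: "u \<asymp> ?r @ (?r @ u)" .
  have "?r @ u \<asymp> reflection_word u l @ u"
    using eq by (intro cong_append coxeter_cong.refl)
  then have "?r @ u \<asymp> v"
    using reflection_word_delete[OF assms(3)] unfolding v_def by (rule coxeter_cong.trans)
  then have "?r @ (?r @ u) \<asymp> ?r @ v"
    by (intro cong_append coxeter_cong.refl)
  moreover have "?r @ v \<asymp> take j v @ drop (Suc j) v"
    using reflection_word_delete[OF v(4)] rv by simp
  ultimately have "u \<asymp> take j v @ drop (Suc j) v"
    using 1 coxeter_cong.trans by blast
  then have "length u \<le> length (take j v @ drop (Suc j) v)"
    using assms(1) reducedD by blast
  then show False
    using v(1,4) assms by simp
qed

end


section \<open>Packing points in Euclidean space\<close>

text \<open>Points at mutual distance at least \<open>d\<close> lie in different cells of a grid of mesh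
  \<open>d / n\<close>.\<close>

lemma separated_card_le:
  fixes A :: "(real ^ 'n) set"
  assumes A: "\<And>x. x \<in> A \<Longrightarrow> norm x \<le> R" and R: "0 \<le> R" and d: "0 < d"
    and sep: "\<And>x y. x \<in> A \<Longrightarrow> y \<in> A \<Longrightarrow> x \<noteq> y \<Longrightarrow> d \<le> norm (x - y)"
  shows "real (card A) \<le> (2 * R * CARD('n) / d + 2) ^ CARD('n)"
proof -
  define h where "h = d / CARD('n)"
  have n: "0 < real CARD('n)"
    by simp
  have h: "0 < h"
    using d by (simp add: h_def)
  define cell where "cell x = (\<lambda>i::'n. \<lfloor>x $ i / h\<rfloor>)" for x :: "real ^ 'n"
  define K where "K = {\<lfloor>- (R / h)\<rfloor>..\<lfloor>R / h\<rfloor>}"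
  have inj: "inj_on cell A"
  proof (rule inj_onI, rule ccontr)
    fix x y assume xy: "x \<in> A" "y \<in> A" "cell x = cell y" "x \<noteq> y"
    have "\<bar>(x - y) $ i\<bar> < h" for i
    proof -
      have "\<lfloor>x $ i / h\<rfloor> = \<lfloor>y $ i / h\<rfloor>"
        using fun_cong[OF xy(3), of i] by (simp add: cell_def)
      then have "\<bar>x $ i / h - y $ i / h\<bar> < 1"
        by linarith
      then show ?thesis
        using h by (simp add: field_simps abs_less_iff)
    qed
    then have "(\<Sum>i\<in>UNIV. \<bar>(x - y) $ i\<bar>) < (\<Sum>i\<in>(UNIV :: 'n set). h)"
      by (intro sum_strict_mono) auto
    then have "norm (x - y) < d"
      using norm_le_l1_cart[of "x - y"] n by (simp add: h_def)
    then show False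
      using sep[OF xy(1,2,4)] by simp
  qed
  have "cell ` A \<subseteq> (\<Pi>\<^sub>E i\<in>UNIV. K)"
  proof (intro image_subsetI PiE_I)
    fix x i assume "x \<in> A"
    then have "\<bar>x $ i\<bar> \<le> R"
      using A component_le_norm_cart[of x i] by (meson order_trans)
    then have "- (R / h) \<le> x $ i / h" "x $ i / h \<le> R / h"
      using h by (simp_all add: field_simps abs_le_iff)
    then show "cell x i \<in> K"
      by (simp add: cell_def K_def floor_mono)
  qed auto
  then have "card (cell ` A) \<le> card (\<Pi>\<^sub>E i\<in>(UNIV :: 'n set). K)"
    by (intro card_mono finite_PiE) (auto simp: K_def)
  then have "card A \<le> card K ^ CARD('n)"
    by (simp add: card_image[OF inj] card_PiE)
  then have "real (card A) \<le> real (card K) ^ CARD('n)"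
    by (metis of_nat_le_iff of_nat_power)
  also have "real (card K) \<le> 2 * R * CARD('n) / d + 2"
  proof -
    have "0 \<le> R / h"
      using R h by simp
    moreover have "real (card K) = real_of_int (\<lfloor>R / h\<rfloor> - \<lfloor>- (R / h)\<rfloor> + 1)"
      using calculation unfolding K_def by simp linarith
    ultimately have "real (card K) \<le> 2 * (R / h) + 2"
      by linarith
    also have "2 * (R / h) = 2 * R * CARD('n) / d"
      by (simp add: h_def)
    finally show ?thesis .
  qed
  then have "real (card K) ^ CARD('n) \<le> (2 * R * CARD('n) / d + 2) ^ CARD('n)"
    by (intro power_mono) auto
  finally show ?thesis .
qed


section \<open>The Lorentzian geometry of the orbit of the base point\<close>

locale lorentzian_coxeter = coxeter_form m B
  for m :: "'n::finite \<Rightarrow> 'n \<Rightarrow> enat" and B +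
  assumes signature: "matrix_signature (gram B) = (CARD('n) - 1, 1)"
    and irreducible: "irreducible_matrix (gram B)"
begin

abbreviation base :: "real ^ 'n" where "base \<equiv> o_vec B"

abbreviation height :: "real ^ 'n \<Rightarrow> real" where "height \<equiv> norm1 B"

text \<open>The negative eigenvalue is \<open>- lam\<close>, because the base point is a unit eigenvector.\<close>

definition lam :: real where "lam = - B base base"

text \<open>A positive lower bound of the form on unit vectors of the hyperplane of height zero.\<close>

definition mu :: real where
  "mu = (SOME c. 0 < c \<and> (\<forall>x. base \<bullet> x = 0 \<longrightarrow> c * (x \<bullet> x) \<le> B x x))"

text \<open>The Perron-Frobenius vector satisfies the defining description of the base point, and uniquely so
  because the negative eigenspace is a line.\<close>

lemma base_properties:
  "0 < lam" "base \<bullet> base = 1" "gram B *v base = (- lam) *\<^sub>R base" "\<forall>i. 0 < base $ i"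
  "0 < mu" "\<forall>x. base \<bullet> x = 0 \<longrightarrow> mu * (x \<bullet> x) \<le> B x x"
proof -
  let ?A = "gram B"
  have sym: "transpose ?A = ?A"
    by (simp add: vec_eq_iff transpose_def B_commute)
  have off: "?A $ i $ j \<le> 0" if "i \<noteq> j" for i j
    using B_root_nonpos[OF that] by simp
  obtain l c u where u: "0 < l" "0 < c" "norm u = 1" "?A *v u = (- l) *\<^sub>R u" "\<forall>i. 0 < u $ i"
    and c: "\<forall>x. u \<bullet> x = 0 \<longrightarrow> c * (x \<bullet> x) \<le> x \<bullet> (?A *v x)"
    and unique: "\<forall>e v. e < 0 \<longrightarrow> v \<in> eigenspace ?A e \<longrightarrow> norm v = 1 \<longrightarrow> (\<forall>i. 0 < v $ i) \<longrightarrow> v = u"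
    using lorentzian_matrix[OF sym off irreducible signature] by blast
  have base_u: "base = u"
    unfolding o_vec_def
  proof (rule the_equality)
    have "u \<in> eigenspace ?A (- l)" "- l < 0"
      using u by (simp_all add: eigenspace_def)
    then show "(\<exists>e<0. u \<in> eigenspace ?A e) \<and> norm u = 1 \<and> (\<forall>i. 0 < u $ i)"
      using u by blast
  next
    fix v assume "(\<exists>e<0. v \<in> eigenspace ?A e) \<and> norm v = 1 \<and> (\<forall>i. 0 < v $ i)"
    then show "v = u"
      using unique by blast
  qed
  have uu: "u \<bullet> u = 1"
    using u(3) by (simp add: norm_eq_1)
  have "B u u = - l"
    using bilinear_gram[OF bilinear_B, of u u] u(4) uu by simp
  then have lam: "lam = l"
    by (simp add: lam_def base_u)
  have "\<exists>c. 0 < c \<and> (\<forall>x. base \<bullet> x = 0 \<longrightarrow> c * (x \<bullet> x) \<le> B x x)"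
    using u(2) c by (auto simp: base_u bilinear_gram[OF bilinear_B])
  then have "0 < mu \<and> (\<forall>x. base \<bullet> x = 0 \<longrightarrow> mu * (x \<bullet> x) \<le> B x x)"
    unfolding mu_def by (rule someI_ex)
  then show "0 < mu" "\<forall>x. base \<bullet> x = 0 \<longrightarrow> mu * (x \<bullet> x) \<le> B x x"
    by blast+
  show "0 < lam" "base \<bullet> base = 1" "gram B *v base = (- lam) *\<^sub>R base" "\<forall>i. 0 < base $ i"
    using u uu lam by (simp_all add: base_u)
qed

lemmas lam_pos = base_properties(1)
  and mu_pos = base_properties(5)

lemma base_pos: "0 < base $ i"
  using base_properties(4) by blast

lemma height_inner: "height v = base \<bullet> v"
  by (simp add: norm1_def inner_vec_def)

lemma height_base [simp]: "height base = 1"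
  by (simp add: height_inner base_properties(2))

lemma height_linear [simp]:
  "height (u + v) = height u + height v" "height (u - v) = height u - height v"
  "height (- u) = - height u" "height (c *\<^sub>R u) = c * height u"
  "height 0 = 0" "height (sum f A) = (\<Sum>x\<in>A. height (f x))"
  by (simp_all add: height_inner inner_add_right inner_diff_right inner_sum_right)

lemma height_root [simp]: "height (simple_root i) = base $ i"
  by (simp add: height_inner inner_axis)

lemma B_base_right: "B v base = - lam * height v"
  by (simp add: bilinear_gram[OF bilinear_B] base_properties(3) height_inner inner_commute)

lemma B_base_left: "B base v = - lam * height v"
  using B_base_right B_commute by metis

lemma B_base_base [simp]: "B base base = - lam"
  by (simp add: B_base_right)

lemma positive_on_height_0: "height x = 0 \<Longrightarrow> mu * (norm x)\<^sup>2 \<le> B x x"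
  using base_properties(6) by (simp add: height_inner power2_norm_eq_inner)

definition cone_const :: real where "cone_const = sqrt (lam / mu) + 1"

lemma cone_const_pos: "0 < cone_const"
  using lam_pos mu_pos by (simp add: cone_const_def add_nonneg_pos)

text \<open>Subtracting the multiple of the base point with the same height leaves a vector on which the form
  is positive definite; for a vector in the light cone it cannot exceed the timelike part.\<close>

lemma norm_le_height:
  assumes "B v v \<le> 0"
  shows "norm v \<le> cone_const * \<bar>height v\<bar>"
proof -
  define x where "x = v - height v *\<^sub>R base"
  have "height x = 0"
    by (simp add: x_def)
  have "B x x = B v v + lam * (height v)\<^sup>2"
    by (simp add: x_def B.diff_left B.diff_right B.scaleR_left B.scaleR_right B_base_left
        B_base_right power2_eq_square algebra_simps)
  then have "mu * (norm x)\<^sup>2 \<le> lam * (height v)\<^sup>2"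
    using positive_on_height_0[OF \<open>height x = 0\<close>] assms by linarith
  then have "(norm x)\<^sup>2 \<le> (lam / mu) * (height v)\<^sup>2"
    using mu_pos by (simp add: field_simps)
  then have "sqrt ((norm x)\<^sup>2) \<le> sqrt ((lam / mu) * (height v)\<^sup>2)"
    by (rule real_sqrt_le_mono)
  then have "norm x \<le> sqrt (lam / mu) * \<bar>height v\<bar>"
    unfolding real_sqrt_mult by simp
  moreover have "norm v \<le> norm x + norm (height v *\<^sub>R base)"
    using norm_triangle_ineq[of x "height v *\<^sub>R base"] by (simp add: x_def)
  moreover have "norm base = 1"
    using base_properties(2) by (simp add: norm_eq_sqrt_inner)
  ultimately show ?thesis
    by (simp add: cone_const_def algebra_simps)
qed

definition bound_B :: real where
  "bound_B = (SOME K. 0 < K \<and> (\<forall>x y. norm (B x y) \<le> norm x * norm y * K))"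

lemma bound_B: "0 < bound_B" "B x x \<le> bound_B * (norm x)\<^sup>2"
proof -
  have "\<exists>K. 0 < K \<and> (\<forall>x y. norm (B x y) \<le> norm x * norm y * K)"
    using B.pos_bounded by blast
  then have K: "0 < bound_B \<and> (\<forall>x y. norm (B x y) \<le> norm x * norm y * bound_B)"
    unfolding bound_B_def by (rule someI_ex)
  then show "0 < bound_B"
    by blast
  have "norm (B x x) \<le> norm x * norm x * bound_B"
    using K by blast
  then show "B x x \<le> bound_B * (norm x)\<^sup>2"
    by (simp add: power2_eq_square mult_ac abs_le_iff)
qed

definition min_base :: real where "min_base = Min (range (($) base))"

lemma min_base: "0 < min_base" "min_base \<le> base $ i"
proof -
  have "min_base \<in> range (($) base)"
    unfolding min_base_def by (intro Min_in) auto
  then show "0 < min_base"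
    using base_pos by auto
  show "min_base \<le> base $ i"
    unfolding min_base_def by (intro Min_le) auto
qed

abbreviation inversion_root :: "'n list \<Rightarrow> nat \<Rightarrow> real ^ 'n" where
  "inversion_root u k \<equiv> act (take k u) (simple_root (u ! k))"

lemma refl_base: "reflect i base = base + (2 * lam * base $ i) *\<^sub>R simple_root i"
  by (simp add: reflection_def B_base_right)

text \<open>Reading the word from the right, each letter moves the base point along its simple root, and the
  letters before it carry that root to an inversion root.\<close>

lemma act_base:
  "act u base = base + (\<Sum>k<length u. (2 * lam * base $ (u ! k)) *\<^sub>R inversion_root u k)"
proof (induction u rule: rev_induct)
  case (snoc i u)
  have "act (u @ [i]) base = act u base + (2 * lam * base $ i) *\<^sub>R act u (simple_root i)"
    by (simp add: refl_base act_add act_scale)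
  moreover have "(\<Sum>k<length u. (2 * lam * base $ ((u @ [i]) ! k)) *\<^sub>R inversion_root (u @ [i]) k)
      = (\<Sum>k<length u. (2 * lam * base $ (u ! k)) *\<^sub>R inversion_root u k)"
    by (intro sum.cong) (auto simp: nth_append)
  ultimately show ?case
    using snoc by (simp add: add.assoc)
qed simp

text \<open>In hyperbolic terms this is \<open>cosh\<close> of the distance between the base point and its image.\<close>

definition orbit_height :: "'n list \<Rightarrow> real" where
  "orbit_height u = height (act u base)"

lemma orbit_height_sum:
  "orbit_height u = 1 + (\<Sum>k<length u. 2 * lam * base $ (u ! k) * height (inversion_root u k))"
  by (simp add: orbit_height_def act_base[of u])

lemma orbit_height_cong: "u \<asymp> v \<Longrightarrow> orbit_height u = orbit_height v"
  by (simp add: orbit_height_def act_cong)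

lemma B_orbit: "B (act u base) (act v base) = - lam * orbit_height (rev u @ v)"
  by (simp add: B_act_left B_base_left orbit_height_def)

lemma B_orbit_self [simp]: "B (act u base) (act u base) = - lam"
  by (simp add: B_act)

text \<open>A root has value one under the form, so it cannot be short; being nonnegative, it cannot have small
  height either.\<close>

lemma inversion_root_height:
  assumes "reduced u" "k < length u"
  shows "min_base / sqrt bound_B \<le> height (inversion_root u k)"
proof -
  let ?b = "inversion_root u k"
  have "take (Suc k) u = take k u @ [u ! k]"
    using assms(2) by (rule take_Suc_conv_app_nth)
  then have "reduced (take k u @ [u ! k])"
    using assms(1) reduced_appendD1 by (metis append_take_drop_id)
  then have nonneg: "0 \<le> ?b $ j" for j
    by (rule reduced_root_nonneg)
  have "1 = B ?b ?b"
    by (simp add: B_act)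
  also have "\<dots> \<le> bound_B * (norm ?b)\<^sup>2"
    by (rule bound_B)
  finally have "sqrt 1 \<le> sqrt (bound_B * (norm ?b)\<^sup>2)"
    by (rule real_sqrt_le_mono)
  then have "1 / sqrt bound_B \<le> norm ?b"
    using bound_B(1) by (simp add: real_sqrt_mult field_simps)
  also have "\<dots> \<le> (\<Sum>j\<in>UNIV. ?b $ j)"
    using norm_le_l1_cart[of ?b] nonneg by simp
  finally have "min_base * (1 / sqrt bound_B) \<le> min_base * (\<Sum>j\<in>UNIV. ?b $ j)"
    using min_base(1) by (intro mult_left_mono) auto
  also have "\<dots> \<le> (\<Sum>j\<in>UNIV. base $ j * ?b $ j)"
    unfolding sum_distrib_left using min_base nonneg by (intro sum_mono mult_right_mono)
  also have "\<dots> = height ?b"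
    by (simp add: norm1_def)
  finally show ?thesis
    by simp
qed

lemma min_base_quotient_pos: "0 < min_base / sqrt bound_B"
  using min_base(1) bound_B(1) by simp

lemma orbit_height_reduced_ge:
  assumes "reduced u"
  shows "1 + 2 * lam * min_base * (\<Sum>k<length u. height (inversion_root u k)) \<le> orbit_height u"
proof -
  have "2 * lam * min_base * height (inversion_root u k)
      \<le> 2 * lam * base $ (u ! k) * height (inversion_root u k)" if "k < length u" for k
  proof (rule mult_right_mono)
    show "2 * lam * min_base \<le> 2 * lam * base $ (u ! k)"
      using lam_pos min_base(2) by (intro mult_left_mono) auto
    show "0 \<le> height (inversion_root u k)"
      using inversion_root_height[OF assms that] min_base_quotient_pos by linarith
  qed
  then show ?thesis
    unfolding orbit_height_sum sum_distrib_left by (intro add_left_mono sum_mono) simp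
qed

lemma orbit_height_ge_1: "1 \<le> orbit_height u"
proof -
  obtain v where v: "u \<asymp> v" "reduced v"
    using ex_reduced by blast
  have "0 \<le> height (inversion_root v k)" if "k < length v" for k
    using inversion_root_height[OF v(2) that] min_base_quotient_pos by linarith
  then have "0 \<le> 2 * lam * min_base * (\<Sum>k<length v. height (inversion_root v k))"
    using lam_pos min_base(1) by (intro mult_nonneg_nonneg sum_nonneg) auto
  then show ?thesis
    using orbit_height_reduced_ge[OF v(2)] orbit_height_cong[OF v(1)] by linarith
qed

lemma orbit_height_pos: "0 < orbit_height u"
  using orbit_height_ge_1[of u] by linarith

definition height_gap :: real where
  "height_gap = 2 * lam * min_base * (min_base / sqrt bound_B)"

lemma height_gap_pos: "0 < height_gap"
  unfolding height_gap_def
  using lam_pos min_base(1) min_base_quotient_pos by (intro mult_pos_pos) simp_all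

text \<open>The first inversion root alone already raises the height by a definite amount.\<close>

lemma orbit_height_gap:
  assumes "\<not> u \<asymp> []"
  shows "1 + height_gap \<le> orbit_height u"
proof -
  obtain v where v: "u \<asymp> v" "reduced v"
    using ex_reduced by blast
  have len: "0 < length v"
    using assms v(1) by (cases v) auto
  have nonneg: "0 \<le> height (inversion_root v k)" if "k < length v" for k
    using inversion_root_height[OF v(2) that] min_base_quotient_pos by linarith
  have "min_base / sqrt bound_B \<le> height (inversion_root v 0)"
    by (rule inversion_root_height[OF v(2) len])
  also have "\<dots> \<le> (\<Sum>k<length v. height (inversion_root v k))"
    using len nonneg by (intro member_le_sum) auto
  finally have "height_gap \<le> 2 * lam * min_base * (\<Sum>k<length v. height (inversion_root v k))"
    unfolding height_gap_def using lam_pos min_base(1) by (intro mult_left_mono) auto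
  then show ?thesis
    using orbit_height_reduced_ge[OF v(2)] orbit_height_cong[OF v(1)] by linarith
qed

lemma norm_orbit_le: "norm (act u base) \<le> cone_const * orbit_height u"
  using norm_le_height[of "act u base"] lam_pos orbit_height_pos[of u]
  by (simp add: orbit_height_def)

text \<open>The form bounds the Euclidean norm from below, and its value on the difference of two orbit points
  is determined by the height of the quotient of the two group elements.\<close>

lemma orbit_separated:
  assumes "\<not> u \<asymp> v"
  shows "sqrt (2 * lam * height_gap / bound_B) \<le> norm (act u base - act v base)"
proof -
  have "\<not> rev u @ v \<asymp> []"
    using cong_cancel_left[of u v "[]"] assms by auto
  then have "1 + height_gap \<le> orbit_height (rev u @ v)"
    by (rule orbit_height_gap)
  then have "2 * lam * height_gap \<le> 2 * lam * (orbit_height (rev u @ v) - 1)"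
    using lam_pos by (intro mult_left_mono) auto
  also have "\<dots> = B (act u base - act v base) (act u base - act v base)"
    by (simp add: B.diff_left B.diff_right B_orbit[of u v]
        B_commute[of "act v base" "act u base"] algebra_simps)
  also have "\<dots> \<le> bound_B * (norm (act u base - act v base))\<^sup>2"
    by (rule bound_B)
  finally have "2 * lam * height_gap / bound_B \<le> (norm (act u base - act v base))\<^sup>2"
    using bound_B(1) by (simp add: field_simps)
  then have "sqrt (2 * lam * height_gap / bound_B) \<le> sqrt ((norm (act u base - act v base))\<^sup>2)"
    by (rule real_sqrt_le_mono)
  then show ?thesis
    by simp
qed

text \<open>The orbit is separated and heights control norms, so elements of bounded height are packed in
  a ball.\<close>

lemma orbit_count:
  "\<exists>D>0. \<forall>T\<ge>0. \<forall>J :: nat set. \<forall>w. finite J \<longrightarrow>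
    (\<forall>j\<in>J. \<forall>l\<in>J. j \<noteq> l \<longrightarrow> \<not> w j \<asymp> w l) \<longrightarrow> (\<forall>j\<in>J. orbit_height (w j) \<le> T) \<longrightarrow>
    real (card J) \<le> (D * T) ^ CARD('n)"
proof -
  define d where "d = sqrt (2 * lam * height_gap / bound_B)"
  have d: "0 < d"
    using lam_pos height_gap_pos bound_B(1) by (simp add: d_def)
  define D where "D = 2 * cone_const * CARD('n) / d + 2"
  have "0 < D"
    using cone_const_pos d by (simp add: D_def add_pos_pos)
  moreover have "real (card J) \<le> (D * T) ^ CARD('n)"
    if T: "0 \<le> T" and J: "finite J" "\<forall>j\<in>J. \<forall>l\<in>J. j \<noteq> l \<longrightarrow> \<not> w j \<asymp> w l"
      "\<forall>j\<in>J. orbit_height (w j) \<le> T" for T and J :: "nat set" and w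
  proof (cases "J = {}")
    case True
    then show ?thesis
      using T \<open>0 < D\<close> by simp
  next
    case False
    then have "1 \<le> T"
      using J(3) orbit_height_ge_1 by (meson ex_in_conv order_trans)
    let ?f = "\<lambda>j. act (w j) base"
    have sep: "d \<le> norm (?f j - ?f l)" if "j \<in> J" "l \<in> J" "j \<noteq> l" for j l
      unfolding d_def using orbit_separated J(2) that by blast
    then have "inj_on ?f J"
      using d by (force intro: inj_onI)
    moreover have "norm x \<le> cone_const * T" if x: "x \<in> ?f ` J" for x
    proof -
      obtain j where j: "j \<in> J" "x = ?f j"
        using x by blast
      have "norm x \<le> cone_const * orbit_height (w j)"
        using norm_orbit_le j by simp
      also have "\<dots> \<le> cone_const * T"
        using cone_const_pos J(3) j by (intro mult_left_mono) auto
      finally show ?thesis .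
    qed
    moreover have "d \<le> norm (x - y)" if "x \<in> ?f ` J" "y \<in> ?f ` J" "x \<noteq> y" for x y
      using that sep by blast
    ultimately have "real (card J) \<le> (2 * (cone_const * T) * CARD('n) / d + 2) ^ CARD('n)"
      using separated_card_le[of "?f ` J" "cone_const * T" d] d T cone_const_pos
      by (simp add: card_image)
    also have "\<dots> \<le> (D * T) ^ CARD('n)"
    proof (rule power_mono)
      show "2 * (cone_const * T) * CARD('n) / d + 2 \<le> D * T"
        using \<open>1 \<le> T\<close> by (simp add: D_def algebra_simps)
      show "0 \<le> 2 * (cone_const * T) * CARD('n) / d + 2"
        using T d cone_const_pos by simp
    qed
    finally show ?thesis .
  qed
  ultimately show ?thesis
    by blast
qed

text \<open>The reflection in a root \<open>b\<close> moves the base point by a multiple of \<open>b\<close> proportional to the height of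
  \<open>b\<close>, whence the square.\<close>

lemma orbit_height_reflection_word:
  "orbit_height (reflection_word u k) = 1 + 2 * lam * (height (inversion_root u k))\<^sup>2"
proof -
  let ?p = "take k u" and ?a = "simple_root (u ! k)"
  have "act (reflection_word u k) base = act ?p (reflect (u ! k) (act (rev ?p) base))"
    by (simp add: reflection_word_def)
  also have "\<dots> = base - (2 * B ?a (act (rev ?p) base)) *\<^sub>R act ?p ?a"
    by (simp add: reflection_def act_diff act_scale)
  also have "B ?a (act (rev ?p) base) = - lam * height (act ?p ?a)"
    using B_act_left[of ?p ?a base] by (simp add: B_base_right)
  finally show ?thesis
    by (simp add: orbit_height_def power2_eq_square)
qed

end


section \<open>Superlinear growth of heights\<close>

context lorentzian_coxeter
begin

definition growth_exponent :: real where "growth_exponent = 1 + 1 / (2 * CARD('n))"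

lemma growth_exponent_gt_1: "1 < growth_exponent"
  by (simp add: growth_exponent_def)

text \<open>The \<open>k\<close> reflections of a reduced word are distinct, and polynomial growth leaves room for at most
  half of them below the height \<open>T\<close>, which is a power of \<open>k\<close>. The roots of the others have height of
  order \<open>sqrt T\<close>, and the heights of all roots add up in the height of the orbit point.\<close>

lemma reduced_height_growth:
  "\<exists>c>0. \<forall>u. reduced u \<longrightarrow> c * real (length u) powr growth_exponent \<le> orbit_height u"
proof -
  obtain D where D: "0 < D" and count: "\<forall>T\<ge>0. \<forall>J :: nat set. \<forall>w. finite J \<longrightarrow>
    (\<forall>j\<in>J. \<forall>l\<in>J. j \<noteq> l \<longrightarrow> \<not> w j \<asymp> w l) \<longrightarrow> (\<forall>j\<in>J. orbit_height (w j) \<le> T) \<longrightarrow>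
    real (card J) \<le> (D * T) ^ CARD('n)"
    using orbit_count by blast
  define n where "n = real CARD('n)"
  have n: "0 < n"
    by (simp add: n_def)
  define q where "q = min_base / sqrt bound_B"
  have q: "0 < q"
    unfolding q_def by (rule min_base_quotient_pos)
  \<comment> \<open>With this constant \<open>1 + 2 lam r\<^sup>2 \<le> E r\<^sup>2\<close> for every height \<open>r \<ge> q\<close> of an inversion root.\<close>
  define E where "E = 1 / q\<^sup>2 + 2 * lam"
  have E: "0 < E"
    using q lam_pos by (simp add: E_def add_pos_pos)
  define e where "e = 1 / (2 * n)"
  define c where "c = lam * min_base * ((1 / 2) powr e / sqrt (D * E))"
  have "0 < c"
    using lam_pos min_base(1) D E by (simp add: c_def)
  moreover have "c * real (length u) powr growth_exponent \<le> orbit_height u" if red: "reduced u" for u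
  proof (cases "u = []")
    case True
    then show ?thesis
      using orbit_height_pos[of u] by simp
  next
    case False
    define k where "k = real (length u)"
    have k: "0 < k"
      using False by (simp add: k_def)
    \<comment> \<open>Chosen so that the bound \<open>(D T)\<^sup>n\<close> on the number of reflections below \<open>T\<close> is \<open>k / 2\<close>.\<close>
    define T where "T = (k / 2) powr (1 / n) / D"
    have T: "0 < T"
      using k D by (simp add: T_def)
    let ?r = "\<lambda>j. height (inversion_root u j)"
    have r: "q \<le> ?r j" if "j < length u" for j
      unfolding q_def by (rule inversion_root_height[OF red that])
    define J where "J = {j. j < length u \<and> orbit_height (reflection_word u j) \<le> T}"
    have distinct: "\<not> reflection_word u j \<asymp> reflection_word u l" if "j \<in> J" "l \<in> J" "j \<noteq> l" for j l
    proof (cases "j < l")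
      case True
      then show ?thesis
        using reflection_words_distinct[OF red] that by (simp add: J_def)
    next
      case False
      then have "\<not> reflection_word u l \<asymp> reflection_word u j"
        using reflection_words_distinct[OF red, of l j] that by (simp add: J_def)
      then show ?thesis
        by (rule contrapos_nn) (rule coxeter_cong.sym)
    qed
    have "real (card J) \<le> (D * T) ^ CARD('n)"
    proof (rule count[rule_format])
      show "finite J" "0 \<le> T"
        using T by (simp_all add: J_def)
      show "orbit_height (reflection_word u j) \<le> T" if "j \<in> J" for j
        using that by (simp add: J_def)
    qed (rule distinct)
    also have "(D * T) ^ CARD('n) = ((k / 2) powr (1 / n)) powr n"
      using D k by (simp add: T_def n_def powr_realpow)
    also have "\<dots> = k / 2"
      using k n by (simp add: powr_powr)
    finally have card_J: "real (card J) \<le> k / 2" .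
    let ?C = "{..<length u} - J"
    have "real (card ?C) = k - real (card J)"
    proof -
      have "J \<subseteq> {..<length u}"
        by (auto simp: J_def)
      then have "card ?C = length u - card J" "card J \<le> length u"
        using card_Diff_subset[of J "{..<length u}"] card_mono[of "{..<length u}" J]
        by (auto simp: finite_subset)
      then show ?thesis
        by (simp add: k_def)
    qed
    then have card_C: "k / 2 \<le> real (card ?C)"
      using card_J by linarith
    have big: "sqrt (T / E) \<le> ?r j" if "j \<in> ?C" for j
    proof -
      have j: "j < length u" "T < 1 + 2 * lam * (?r j)\<^sup>2"
        using that by (auto simp: J_def orbit_height_reflection_word)
      have "1 \<le> (?r j)\<^sup>2 / q\<^sup>2"
        using r[OF j(1)] q by (simp add: power_mono)
      then have "T \<le> E * (?r j)\<^sup>2"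
        using j(2) by (simp add: E_def algebra_simps)
      then have "sqrt (T / E) \<le> sqrt ((?r j)\<^sup>2)"
        using E by (intro real_sqrt_le_mono) (simp add: field_simps)
      then show ?thesis
        using r[OF j(1)] q by simp
    qed
    have "(k / 2) * sqrt (T / E) \<le> real (card ?C) * sqrt (T / E)"
      using card_C T E by (intro mult_right_mono) auto
    also have "\<dots> \<le> (\<Sum>j\<in>?C. ?r j)"
      using sum_bounded_below[of ?C "sqrt (T / E)" ?r] big by simp
    also have "\<dots> \<le> (\<Sum>j<length u. ?r j)"
    proof (rule sum_mono2)
      show "0 \<le> ?r j" if "j \<in> {..<length u} - ?C" for j
        using r[of j] q that by simp
    qed auto
    finally have sum_ge: "(k / 2) * sqrt (T / E) \<le> (\<Sum>j<length u. ?r j)" .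
    have "sqrt (T / E) = sqrt ((k / 2) powr (1 / n)) / sqrt (D * E)"
      by (simp add: T_def real_sqrt_divide real_sqrt_mult)
    also have "sqrt ((k / 2) powr (1 / n)) = (k / 2) powr e"
      using k by (simp add: e_def powr_powr mult.commute[of n] flip: powr_half_sqrt)
    also have "\<dots> = k powr e * (1 / 2) powr e"
      using k powr_mult[of k "1 / 2" e] by simp
    finally have root: "sqrt (T / E) = k powr e * (1 / 2) powr e / sqrt (D * E)" .
    have "growth_exponent = 1 + e"
      by (simp add: growth_exponent_def e_def n_def)
    then have "c * k powr growth_exponent = 2 * lam * min_base * ((k / 2) * sqrt (T / E))"
      using k by (simp add: c_def root powr_add)
    also have "\<dots> \<le> 2 * lam * min_base * (\<Sum>j<length u. ?r j)"
      using sum_ge lam_pos min_base(1) by (intro mult_left_mono) auto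
    also have "\<dots> \<le> orbit_height u"
      using orbit_height_reduced_ge[OF red] by linarith
    finally show ?thesis
      by (simp add: k_def)
  qed
  ultimately show ?thesis
    by blast
qed

lemma height_growth:
  "\<exists>c>0. \<forall>u. c * real (Suc (len u)) powr growth_exponent \<le> orbit_height u"
proof -
  obtain c where c: "0 < c"
    "\<forall>u. reduced u \<longrightarrow> c * real (length u) powr growth_exponent \<le> orbit_height u"
    using reduced_height_growth by blast
  \<comment> \<open>The factor compensates \<open>len u + 1 \<le> 2 len u\<close>; the minimum covers the identity.\<close>
  define b where "b = min 1 (c / 2 powr growth_exponent)"
  have "0 < b"
    using c(1) by (simp add: b_def)
  moreover have "b * real (Suc (len u)) powr growth_exponent \<le> orbit_height u" for u
  proof -
    obtain v where v: "u \<asymp> v" "reduced v" "length v = len u"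
      using ex_reduced_len by blast
    show ?thesis
    proof (cases "len u = 0")
      case True
      then show ?thesis
        using orbit_height_ge_1[of u] by (simp add: b_def)
    next
      case False
      have "real (Suc (len u)) powr growth_exponent \<le> (2 * real (len u)) powr growth_exponent"
        using False growth_exponent_gt_1 by (intro powr_mono2) auto
      also have "\<dots> = 2 powr growth_exponent * real (len u) powr growth_exponent"
        by (simp add: powr_mult)
      finally have "b * real (Suc (len u)) powr growth_exponent
          \<le> b * (2 powr growth_exponent * real (len u) powr growth_exponent)"
        using \<open>0 < b\<close> by (intro mult_left_mono) auto
      also have "\<dots> \<le> (c / 2 powr growth_exponent) *
          (2 powr growth_exponent * real (len u) powr growth_exponent)"
        by (intro mult_right_mono) (auto simp: b_def)
      also have "\<dots> = c * real (length v) powr growth_exponent"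
        by (simp add: v(3))
      also have "\<dots> \<le> orbit_height u"
        using c(2)[rule_format, OF v(2)] orbit_height_cong[OF v(1)] by simp
      finally show ?thesis .
    qed
  qed
  ultimately show ?thesis
    by blast
qed


section \<open>Contraction of the Cayley graph under the normalized action\<close>

definition orbit_point :: "'n list \<Rightarrow> real ^ 'n" where
  "orbit_point u = act u base /\<^sub>R orbit_height u"

lemma orbit_point_cong: "u \<asymp> v \<Longrightarrow> orbit_point u = orbit_point v"
  by (simp add: orbit_point_def act_cong orbit_height_cong)

lemma height_orbit_point [simp]: "height (orbit_point u) = 1"
  using orbit_height_pos[of u] by (simp add: orbit_point_def flip: orbit_height_def)

lemma B_orbit_point:
  "B (orbit_point u) (orbit_point v)
    = - lam * orbit_height (rev u @ v) / (orbit_height u * orbit_height v)"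
  by (simp add: orbit_point_def B.scaleR_left B.scaleR_right B_orbit[of u v] field_simps)

text \<open>The difference of two points of height one has height zero, where the form is positive
  definite.\<close>

lemma orbit_point_dist:
  "(norm (orbit_point u - orbit_point v))\<^sup>2
    \<le> 2 * lam / mu * orbit_height (rev u @ v) / (orbit_height u * orbit_height v)"
proof -
  let ?x = "orbit_point u" and ?y = "orbit_point v"
  have neg: "B (orbit_point w) (orbit_point w) \<le> 0" for w
    unfolding B_orbit_point
    using lam_pos orbit_height_pos[of w] orbit_height_pos[of "rev w @ w"] by (simp add: field_simps)
  have "mu * (norm (?x - ?y))\<^sup>2 \<le> B (?x - ?y) (?x - ?y)"
    by (rule positive_on_height_0) simp
  also have "\<dots> = B ?x ?x + B ?y ?y - 2 * B ?x ?y"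
    using B_commute[of ?y ?x] by (simp add: B.diff_left B.diff_right)
  also have "\<dots> \<le> - 2 * B ?x ?y"
    using neg[of u] neg[of v] by linarith
  also have "\<dots> = 2 * lam * orbit_height (rev u @ v) / (orbit_height u * orbit_height v)"
    by (simp add: B_orbit_point)
  finally have "(norm (?x - ?y))\<^sup>2
      \<le> 2 * lam * orbit_height (rev u @ v) / (orbit_height u * orbit_height v) / mu"
    by (subst pos_le_divide_eq[OF mu_pos]) (simp only: mult.commute[of _ mu])
  also have "\<dots> = 2 * lam / mu * orbit_height (rev u @ v) / (orbit_height u * orbit_height v)"
    by (simp add: mult_ac)
  finally show ?thesis .
qed

lemma inverse_sqrt_product_le:
  fixes a b :: real
  assumes "0 < a" "0 < b"
  shows "1 / sqrt (a * b) \<le> 1 / a + 1 / b"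
proof (cases "a \<le> b")
  case True
  have "a = sqrt (a * a)"
    using assms by simp
  also have "\<dots> \<le> sqrt (a * b)"
    using True assms by (intro real_sqrt_le_mono mult_left_mono) auto
  finally have "1 / sqrt (a * b) \<le> 1 / a"
    using assms by (intro divide_left_mono) auto
  moreover have "0 \<le> 1 / b"
    using assms by simp
  ultimately show ?thesis
    by linarith
next
  case False
  have "b = sqrt (b * b)"
    using assms by simp
  also have "\<dots> \<le> sqrt (a * b)"
    using False assms by (intro real_sqrt_le_mono mult_right_mono) auto
  finally have "1 / sqrt (a * b) \<le> 1 / b"
    using assms by (intro divide_left_mono) auto
  moreover have "0 \<le> 1 / a"
    using assms by simp
  ultimately show ?thesis
    by linarith
qed

text \<open>Neighbours in the Cayley graph differ by a generator, so the numerator in the previous bound is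
  bounded.\<close>

lemma orbit_point_step:
  "norm (orbit_point u - orbit_point (u @ [i]))
    \<le> sqrt (2 * lam / mu * (1 + 2 * lam)) * (1 / orbit_height u + 1 / orbit_height (u @ [i]))"
proof -
  let ?a = "orbit_height u" and ?b = "orbit_height (u @ [i])"
  let ?K = "2 * lam / mu * (1 + 2 * lam)"
  have "norm base = 1"
    using base_properties(2) by (simp add: norm_eq_sqrt_inner)
  then have "base $ i \<le> 1"
    using component_le_norm_cart[of base i] by simp
  then have "(base $ i)\<^sup>2 \<le> 1"
    using base_pos[of i] by (simp add: power_le_one)
  moreover have "rev u @ u @ [i] \<asymp> [i]"
    using cong_append[OF cong_rev_self coxeter_cong.refl, of u "[i]"] by simp
  then have "orbit_height (rev u @ u @ [i]) = 1 + 2 * lam * (base $ i)\<^sup>2"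
    by (simp add: orbit_height_cong orbit_height_sum[of "[i]"] power2_eq_square)
  ultimately have h: "orbit_height (rev u @ u @ [i]) \<le> 1 + 2 * lam"
    using lam_pos mult_left_mono[of "(base $ i)\<^sup>2" 1 "2 * lam"] by simp
  have "(norm (orbit_point u - orbit_point (u @ [i])))\<^sup>2
      \<le> 2 * lam / mu * orbit_height (rev u @ u @ [i]) / (?a * ?b)"
    by (rule orbit_point_dist)
  also have "\<dots> \<le> ?K / (?a * ?b)"
    using h lam_pos mu_pos orbit_height_pos[of u] orbit_height_pos[of "u @ [i]"]
    by (intro divide_right_mono mult_left_mono) auto
  finally have "sqrt ((norm (orbit_point u - orbit_point (u @ [i])))\<^sup>2) \<le> sqrt (?K / (?a * ?b))"
    by (rule real_sqrt_le_mono)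
  then have "norm (orbit_point u - orbit_point (u @ [i])) \<le> sqrt ?K * (1 / sqrt (?a * ?b))"
    by (simp only: real_sqrt_divide real_sqrt_abs abs_norm_cancel times_divide_eq_right mult_1_right)
  also have "\<dots> \<le> sqrt ?K * (1 / ?a + 1 / ?b)"
    using lam_pos mu_pos inverse_sqrt_product_le orbit_height_pos[of u] orbit_height_pos[of "u @ [i]"]
    by (intro mult_left_mono) auto
  finally show ?thesis .
qed

lemma summable_edge_bound:
  "\<exists>\<phi> :: nat \<Rightarrow> real. (\<forall>j. 0 \<le> \<phi> j) \<and> (\<forall>j l. j \<le> l \<longrightarrow> \<phi> l \<le> \<phi> j) \<and> summable \<phi> \<and>
    (\<forall>u i. norm (orbit_point u - orbit_point (u @ [i])) \<le> \<phi> (len u) + \<phi> (len (u @ [i])))"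
proof -
  obtain c where c: "0 < c" "\<forall>u. c * real (Suc (len u)) powr growth_exponent \<le> orbit_height u"
    using height_growth by blast
  define K where "K = sqrt (2 * lam / mu * (1 + 2 * lam))"
  have K: "0 \<le> K"
    using lam_pos mu_pos by (simp add: K_def)
  define \<phi> where "\<phi> j = K / c * real (Suc j) powr (- growth_exponent)" for j :: nat
  have "0 \<le> \<phi> j" for j
    using K c(1) by (simp add: \<phi>_def)
  moreover have "\<phi> l \<le> \<phi> j" if "j \<le> l" for j l
    unfolding \<phi>_def using that K c(1) growth_exponent_gt_1
    by (intro mult_left_mono powr_mono2') auto
  moreover have "summable \<phi>"
  proof -
    have "summable (\<lambda>j. real j powr (- growth_exponent))"
      using growth_exponent_gt_1 by (subst summable_real_powr_iff) simp
    then have "summable (\<lambda>j. real (Suc j) powr (- growth_exponent))"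
      by (subst summable_Suc_iff)
    then show ?thesis
      unfolding \<phi>_def by (rule summable_mult)
  qed
  moreover have bound: "K * (1 / orbit_height u) \<le> \<phi> (len u)" for u
  proof -
    have "1 / orbit_height u \<le> 1 / (c * real (Suc (len u)) powr growth_exponent)"
      using c orbit_height_pos[of u] by (intro divide_left_mono) auto
    also have "\<dots> = 1 / c * real (Suc (len u)) powr (- growth_exponent)"
      by (simp add: powr_minus field_simps)
    finally have "K * (1 / orbit_height u) \<le> K * (1 / c * real (Suc (len u)) powr (- growth_exponent))"
      using K by (rule mult_left_mono)
    then show ?thesis
      by (simp add: \<phi>_def)
  qed
  have "norm (orbit_point u - orbit_point (u @ [i])) \<le> \<phi> (len u) + \<phi> (len (u @ [i]))" for u i
  proof -
    have "norm (orbit_point u - orbit_point (u @ [i]))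
        \<le> K * (1 / orbit_height u) + K * (1 / orbit_height (u @ [i]))"
      using orbit_point_step[of u i] by (simp add: K_def distrib_left)
    then show ?thesis
      using bound[of u] bound[of "u @ [i]"] by linarith
  qed
  ultimately show ?thesis
    by blast
qed

lemma sum_inj_le_suminf:
  fixes \<psi> :: "nat \<Rightarrow> real"
  assumes "summable \<psi>" "\<And>j. 0 \<le> \<psi> j" "finite A" "inj_on f A"
  shows "(\<Sum>k\<in>A. \<psi> (f k)) \<le> suminf \<psi>"
proof -
  have "(\<Sum>k\<in>A. \<psi> (f k)) = sum \<psi> (f ` A)"
    using assms(4) by (simp add: sum.reindex)
  also have "\<dots> \<le> suminf \<psi>"
    using assms by (intro sum_le_suminf) auto
  finally show ?thesis .
qed

text \<open>Floyd's argument. A vertex at distance \<open>k\<close> from \<open>u\<close> on a geodesic of length \<open>N\<close> from \<open>u\<close> to \<open>v\<close> has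
  length at least \<open>len u - k\<close> and at least \<open>len v - (N - k)\<close>. The first bound is at least \<open>R\<close> on an initial
  part of the geodesic and the second one on the rest, and on each part its values are distinct.\<close>

lemma gromov_product_contraction:
  "\<exists>\<epsilon> :: nat \<Rightarrow> real. \<epsilon> \<longlonglongrightarrow> 0 \<and>
    (\<forall>u v R. len (rev u @ v) + 2 * R \<le> len u + len v \<longrightarrow>
      norm (orbit_point u - orbit_point v) \<le> \<epsilon> R)"
proof -
  obtain \<phi> :: "nat \<Rightarrow> real" where phi: "\<forall>j. 0 \<le> \<phi> j" "\<forall>j l. j \<le> l \<longrightarrow> \<phi> l \<le> \<phi> j" "summable \<phi>"
    and edge: "\<forall>u i. norm (orbit_point u - orbit_point (u @ [i])) \<le> \<phi> (len u) + \<phi> (len (u @ [i]))"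
    using summable_edge_bound by blast
  define tail where "tail R = (\<Sum>j. \<phi> (j + R))" for R
  have "tail \<longlonglongrightarrow> 0"
    unfolding tail_def by (rule suminf_exist_split2[OF phi(3)])
  then have "(\<lambda>R. 4 * tail R) \<longlonglongrightarrow> 0"
    by (rule tendsto_mult_right_zero)
  moreover have "norm (orbit_point u - orbit_point v) \<le> 4 * tail R"
    if R: "len (rev u @ v) + 2 * R \<le> len u + len v" for u v R
  proof -
    obtain w where w: "rev u @ v \<asymp> w" "length w = len (rev u @ v)"
      using ex_reduced_len by blast
    define N where "N = length w"
    define p where "p k = u @ take k w" for k
    have v_eq: "v \<asymp> u @ w"
      using cong_cancel_left[OF w(1)] by (rule coxeter_cong.sym)
    have len_u: "len u \<le> len (p k) + k" if "k \<le> N" for k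
    proof -
      have "u @ take k w @ rev (take k w) \<asymp> u @ []"
        by (intro cong_append coxeter_cong.refl cong_self_rev)
      then have "len u = len (p k @ rev (take k w))"
        using len_cong by (simp add: p_def)
      also have "\<dots> \<le> len (p k) + len (rev (take k w))"
        by (rule len_append)
      also have "len (rev (take k w)) \<le> k"
        using len_le[OF coxeter_cong.refl, of "rev (take k w)"] by simp
      finally show ?thesis
        by simp
    qed
    have len_v: "len v + k \<le> len (p k) + N" if "k \<le> N" for k
    proof -
      have "len v = len (p k @ drop k w)"
        using len_cong[OF v_eq] by (simp add: p_def)
      also have "\<dots> \<le> len (p k) + len (drop k w)"
        by (rule len_append)
      also have "len (drop k w) \<le> N - k"
        using len_le[OF coxeter_cong.refl, of "drop k w"] by (simp add: N_def)
      finally show ?thesis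
        using that by simp
    qed
    have step: "norm (orbit_point (p k) - orbit_point (p (Suc k))) \<le> \<phi> (len (p k)) + \<phi> (len (p (Suc k)))"
      if "k < N" for k
    proof -
      have "p (Suc k) = p k @ [w ! k]"
        using that by (simp add: p_def N_def take_Suc_conv_app_nth)
      then show ?thesis
        using edge by simp
    qed
    have "orbit_point u - orbit_point v = orbit_point (p 0) - orbit_point (p N)"
      using orbit_point_cong[OF v_eq] by (simp add: p_def N_def)
    also have "\<dots> = (\<Sum>k<N. orbit_point (p k) - orbit_point (p (Suc k)))"
      by (rule sum_lessThan_telescope'[symmetric, of "\<lambda>k. orbit_point (p k)"])
    finally have "norm (orbit_point u - orbit_point v)
        \<le> (\<Sum>k<N. norm (orbit_point (p k) - orbit_point (p (Suc k))))"
      by (simp add: norm_sum)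
    also have "\<dots> \<le> (\<Sum>k<N. \<phi> (len (p k)) + \<phi> (len (p (Suc k))))"
      using step by (intro sum_mono) auto
    also have "\<dots> = (\<Sum>k<N. \<phi> (len (p k))) + (\<Sum>k<N. \<phi> (len (p (Suc k))))"
      by (rule sum.distrib)
    also have "\<dots> \<le> 2 * (\<Sum>k\<le>N. \<phi> (len (p k)))"
    proof -
      have "(\<Sum>k<N. \<phi> (len (p k))) \<le> (\<Sum>k\<le>N. \<phi> (len (p k)))"
        using phi(1) by (intro sum_mono2) auto
      moreover have "(\<Sum>k<N. \<phi> (len (p (Suc k)))) \<le> (\<Sum>k\<le>N. \<phi> (len (p k)))"
        using phi(1) by (simp add: sum.atMost_shift)
      ultimately show ?thesis
        by simp
    qed
    also have "(\<Sum>k\<le>N. \<phi> (len (p k))) \<le> 2 * tail R"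
    proof -
      define A where "A = {k. k \<le> N \<and> k + R \<le> len u}"
      define C where "C = {k. k \<le> N \<and> \<not> k + R \<le> len u}"
      have fin: "finite A" "finite C"
        by (auto simp: A_def C_def)
      have sum_shift: "summable (\<lambda>j. \<phi> (j + R))"
        using phi(3) by (rule summable_ignore_initial_segment)
      have C_R: "N + R \<le> len v + k" if "k \<in> C" for k
        using R that by (simp add: C_def N_def w(2))
      have "(\<Sum>k\<in>A. \<phi> (len (p k))) \<le> (\<Sum>k\<in>A. \<phi> ((len u - k - R) + R))"
      proof (intro sum_mono)
        fix k assume k: "k \<in> A"
        then have "len u - k - R + R \<le> len (p k)"
          using len_u[of k] by (simp add: A_def)
        then show "\<phi> (len (p k)) \<le> \<phi> (len u - k - R + R)"
          using phi(2) by blast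
      qed
      also have "\<dots> \<le> tail R"
        unfolding tail_def using phi(1) sum_shift fin
        by (intro sum_inj_le_suminf[where \<psi> = "\<lambda>j. \<phi> (j + R)"]) (auto intro!: inj_onI simp: A_def)
      finally have 1: "(\<Sum>k\<in>A. \<phi> (len (p k))) \<le> tail R" .
      have "(\<Sum>k\<in>C. \<phi> (len (p k))) \<le> (\<Sum>k\<in>C. \<phi> ((len v + k - N - R) + R))"
      proof (intro sum_mono)
        fix k assume k: "k \<in> C"
        then have "len v + k - N - R + R \<le> len (p k)"
          using len_v[of k] C_R[OF k] by (simp add: C_def)
        then show "\<phi> (len (p k)) \<le> \<phi> (len v + k - N - R + R)"
          using phi(2) by blast
      qed
      also have "\<dots> \<le> tail R"
        unfolding tail_def
      proof (intro sum_inj_le_suminf[where \<psi> = "\<lambda>j. \<phi> (j + R)"] sum_shift fin inj_onI)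
        fix k l assume "k \<in> C" "l \<in> C" "len v + k - N - R = len v + l - N - R"
        then show "k = l"
          using C_R[of k] C_R[of l] by linarith
      qed (use phi(1) in auto)
      finally have 2: "(\<Sum>k\<in>C. \<phi> (len (p k))) \<le> tail R" .
      have "{..N} = A \<union> C" "A \<inter> C = {}"
        by (auto simp: A_def C_def)
      then have "(\<Sum>k\<le>N. \<phi> (len (p k))) = (\<Sum>k\<in>A. \<phi> (len (p k))) + (\<Sum>k\<in>C. \<phi> (len (p k)))"
        using fin by (simp add: sum.union_disjoint)
      then show ?thesis
        using 1 2 by linarith
    qed
    finally show ?thesis
      by simp
  qed
  ultimately show ?thesis
    by blast
qed

text \<open>This places the limits of orbit points on the light cone.\<close>

lemma orbit_height_at_top:
  "\<exists>\<eta> :: nat \<Rightarrow> real. \<eta> \<longlonglongrightarrow> 0 \<and> (\<forall>u. 1 / orbit_height u \<le> \<eta> (len u))"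
proof -
  obtain c where c: "0 < c" "\<forall>u. c * real (Suc (len u)) powr growth_exponent \<le> orbit_height u"
    using height_growth by blast
  have "(\<lambda>j. real (Suc j) powr (- growth_exponent)) \<longlonglongrightarrow> 0"
  proof -
    have "(\<lambda>j. real j powr (- growth_exponent)) \<longlonglongrightarrow> 0"
      using growth_exponent_gt_1 by (intro tendsto_neg_powr filterlim_real_sequentially) simp
    then show ?thesis
      by (rule LIMSEQ_Suc)
  qed
  then have "(\<lambda>j. 1 / c * real (Suc j) powr (- growth_exponent)) \<longlonglongrightarrow> 0"
    by (rule tendsto_mult_right_zero)
  moreover have "1 / orbit_height u \<le> 1 / c * real (Suc (len u)) powr (- growth_exponent)" for u
  proof -
    have "1 / orbit_height u \<le> 1 / (c * real (Suc (len u)) powr growth_exponent)"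
      using c orbit_height_pos[of u] by (intro divide_left_mono) auto
    then show ?thesis
      by (simp add: powr_minus field_simps)
  qed
  ultimately show ?thesis
    by blast
qed

end


section \<open>The group acting on the orbit\<close>

lemma (in coxeter_words) cong_rev:
  assumes "u \<asymp> v"
  shows "rev u \<asymp> rev v"
proof -
  have 1: "rev u @ (u @ rev v) \<asymp> rev u @ (v @ rev v)"
    using assms by (intro cong_append coxeter_cong.refl)
  have 2: "rev u @ v @ rev v \<asymp> rev u @ []"
    by (intro cong_append coxeter_cong.refl cong_self_rev)
  have 3: "(rev u @ u) @ rev v \<asymp> [] @ rev v"
    by (intro cong_append coxeter_cong.refl cong_rev_self)
  have "rev u @ (u @ rev v) \<asymp> rev u"
    using coxeter_cong.trans[OF 1 2] by simp
  then have "rev u \<asymp> rev u @ (u @ rev v)"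
    by (rule coxeter_cong.sym)
  then show ?thesis
    using 3 coxeter_cong.trans[of m "rev u" "rev u @ (u @ rev v)" "rev v"] by simp
qed

lemma (in coxeter_words) len_rev [simp]: "len (rev u) = len u"
proof -
  have le: "len (rev w) \<le> len w" for w
  proof -
    obtain v where v: "w \<asymp> v" "length v = len w"
      using ex_reduced_len by blast
    show ?thesis
      using len_le[OF cong_rev[OF v(1)]] v(2) by simp
  qed
  show ?thesis
    using le[of u] le[of "rev u"] by simp
qed

locale lorentzian_coxeter_group = lorentzian_coxeter m B
  for m :: "'n::finite \<Rightarrow> 'n \<Rightarrow> enat" and B +
  fixes G :: "('a, 'b) monoid_scheme" and s :: "'n \<Rightarrow> 'a"
  assumes system: "coxeter_system G s m"
begin

sublocale G: group G
  using system by (simp add: coxeter_system_def)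

abbreviation wp :: "'n list \<Rightarrow> 'a" where "wp \<equiv> word_prod G s"

lemma generator_closed: "s i \<in> carrier G"
  using system by (auto simp: coxeter_system_def)

lemma wp_Nil [simp]: "wp [] = \<one>\<^bsub>G\<^esub>"
  by (simp add: word_prod_def)

lemma wp_Cons: "wp (i # u) = s i \<otimes>\<^bsub>G\<^esub> wp u"
  by (simp add: word_prod_def)

lemma wp_closed [simp]: "wp u \<in> carrier G"
  by (induction u) (simp_all add: wp_Cons generator_closed)

lemma wp_append: "wp (u @ v) = wp u \<otimes>\<^bsub>G\<^esub> wp v"
  by (induction u) (simp_all add: wp_Cons generator_closed G.m_assoc)

lemma wp_eq_iff: "wp u = wp v \<longleftrightarrow> u \<asymp> v"
  using system unfolding coxeter_system_def by (elim conjE) simp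

lemma wp_rev: "wp (rev u) = inv\<^bsub>G\<^esub> wp u"
proof -
  have "wp (rev u) \<otimes>\<^bsub>G\<^esub> wp u = wp []"
    using wp_eq_iff[of "rev u @ u" "[]"] cong_rev_self by (simp add: wp_append)
  then show ?thesis
    using G.inv_equality[of "wp (rev u)" "wp u"] by simp
qed

text \<open>The generators are involutions, so inverses of generators are again words.\<close>

lemma wp_surj:
  assumes "g \<in> carrier G"
  obtains u where "g = wp u"
proof -
  have single: "wp [i] = s i" for i
    by (simp add: wp_Cons generator_closed)
  have "g \<in> generate G (range s)"
    using system assms by (simp add: coxeter_system_def)
  then have "\<exists>u. g = wp u"
  proof induction
    case one
    then show ?case
      using wp_Nil by metis
  next
    case (incl h)
    then show ?case
      using single by (metis rangeE)
  next
    case (inv h)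
    then obtain i where "h = wp [i]"
      using single by (metis rangeE)
    then have "inv\<^bsub>G\<^esub> h = wp (rev [i])"
      by (simp only: wp_rev)
    then show ?case
      by blast
  next
    case (eng h k)
    then obtain u v where "h = wp u" "k = wp v"
      by blast
    then have "h \<otimes>\<^bsub>G\<^esub> k = wp (u @ v)"
      by (simp only: wp_append)
    then show ?case
      by blast
  qed
  then show thesis
    using that by blast
qed

lemma word_length_wp: "word_length G s (wp u) = len u"
proof -
  have "(length v = k \<and> wp v = wp u) \<longleftrightarrow> (length v = k \<and> u \<asymp> v)" for v k
    using wp_eq_iff[of u v] by auto
  then show ?thesis
    by (simp add: word_length_def len_def)
qed

lemma word_dist_wp: "word_dist G s (wp u) (wp v) = real (len (rev u @ v))"
  using word_length_wp[of "rev u @ v"] by (simp add: word_dist_def wp_append wp_rev)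

abbreviation gp :: "'a \<Rightarrow> 'a \<Rightarrow> real" where
  "gp \<equiv> gromov_product (word_dist G s) \<one>\<^bsub>G\<^esub>"

lemma gp_wp: "gp (wp u) (wp v) = (real (len u) + real (len v) - real (len (rev u @ v))) / 2"
  using word_dist_wp[of u "[]"] word_dist_wp[of v "[]"]
  by (simp add: gromov_product_def word_dist_wp)

lemma linear_act_wp: "linear_act G s B (wp u) v = act u v"
  unfolding linear_act_def
proof (rule the_equality)
  show "\<exists>w. wp w = wp u \<and> act u v = act w v"
    by blast
  fix v' assume "\<exists>w. wp w = wp u \<and> v' = act w v"
  then obtain w where "w \<asymp> u" "v' = act w v"
    using wp_eq_iff by blast
  then show "v' = act u v"
    by (simp add: act_cong)
qed

lemma normalized_act_wp: "normalized_act G s B (wp u) v = act u v /\<^sub>R height (act u v)"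
  by (simp add: normalized_act_def normalize_vec_def linear_act_wp)

definition orb :: "'a \<Rightarrow> real ^ 'n" where
  "orb g = normalized_act G s B g base"

lemma orb_wp: "orb (wp u) = orbit_point u"
  by (simp add: orb_def normalized_act_wp orbit_point_def orbit_height_def)

lemma orb_mult:
  "orb (wp w \<otimes>\<^bsub>G\<^esub> wp u) = act w (orb (wp u)) /\<^sub>R height (act w (orb (wp u)))"
proof -
  have "act w (orbit_point u) = act (w @ u) base /\<^sub>R orbit_height u"
    by (simp add: orbit_point_def act_scale)
  then show ?thesis
    using orbit_height_pos[of u] orb_wp[of "w @ u"]
    by (simp add: orb_wp wp_append) (simp add: orbit_point_def orbit_height_def)
qed

definition modulus :: "nat \<Rightarrow> real" where
  "modulus = (SOME \<epsilon>. \<epsilon> \<longlonglongrightarrow> 0 \<and>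
    (\<forall>u v R. len (rev u @ v) + 2 * R \<le> len u + len v \<longrightarrow>
      norm (orbit_point u - orbit_point v) \<le> \<epsilon> R))"

lemma modulus:
  "modulus \<longlonglongrightarrow> 0"
  "\<forall>u v R. len (rev u @ v) + 2 * R \<le> len u + len v \<longrightarrow>
      norm (orbit_point u - orbit_point v) \<le> modulus R"
  using someI_ex[OF gromov_product_contraction] unfolding modulus_def by blast+

lemma orb_contraction:
  assumes "g \<in> carrier G" "h \<in> carrier G" "real R \<le> gp g h"
  shows "norm (orb g - orb h) \<le> modulus R"
proof -
  obtain u v where uv: "g = wp u" "h = wp v"
    using wp_surj assms(1,2) by metis
  then have "real (len (rev u @ v) + 2 * R) \<le> real (len u + len v)"
    using assms(3) by (simp add: gp_wp)
  then have "len (rev u @ v) + 2 * R \<le> len u + len v"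
    by (simp only: of_nat_le_iff)
  then show ?thesis
    using modulus(2) by (simp add: uv orb_wp)
qed


section \<open>Endpoints of Gromov sequences\<close>

abbreviation gromov_seqs :: "(nat \<Rightarrow> 'a) set" where
  "gromov_seqs \<equiv> gromov_sequences (carrier G) (word_dist G s) \<one>\<^bsub>G\<^esub>"

lemma gromov_seqs_iff:
  "x \<in> gromov_seqs \<longleftrightarrow>
    (\<forall>i. x i \<in> carrier G) \<and> (\<forall>R. \<exists>N. \<forall>i\<ge>N. \<forall>j\<ge>N. real R \<le> gp (x i) (x j))"
proof -
  have "filterlim (\<lambda>(i, j). gp (x i) (x j)) at_top (sequentially \<times>\<^sub>F sequentially) \<longleftrightarrow>
    (\<forall>Z. \<exists>N. \<forall>i\<ge>N. \<forall>j\<ge>N. Z \<le> gp (x j) (x i))"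
    unfolding filterlim_at_top by (simp add: eventually_prod_sequentially)
  also have "\<dots> \<longleftrightarrow> (\<forall>R. \<exists>N. \<forall>i\<ge>N. \<forall>j\<ge>N. real R \<le> gp (x i) (x j))"
  proof
    assume "\<forall>Z. \<exists>N. \<forall>i\<ge>N. \<forall>j\<ge>N. Z \<le> gp (x j) (x i)"
    then show "\<forall>R. \<exists>N. \<forall>i\<ge>N. \<forall>j\<ge>N. real R \<le> gp (x i) (x j)"
      by meson
  next
    assume R: "\<forall>R. \<exists>N. \<forall>i\<ge>N. \<forall>j\<ge>N. real R \<le> gp (x i) (x j)"
    show "\<forall>Z. \<exists>N. \<forall>i\<ge>N. \<forall>j\<ge>N. Z \<le> gp (x j) (x i)"
    proof
      fix Z
      obtain R where "Z \<le> real R"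
        using real_arch_simple by blast
      then show "\<exists>N. \<forall>i\<ge>N. \<forall>j\<ge>N. Z \<le> gp (x j) (x i)"
        using R by (meson order_trans)
    qed
  qed
  finally show ?thesis
    by (auto simp: gromov_sequences_def image_subset_iff)
qed

lemma gromov_seqs_closed: "x \<in> gromov_seqs \<Longrightarrow> x i \<in> carrier G"
  by (simp add: gromov_seqs_iff)

definition endpoint :: "(nat \<Rightarrow> 'a) \<Rightarrow> real ^ 'n" where
  "endpoint x = lim (\<lambda>i. orb (x i))"

lemma modulus_small:
  assumes "0 < e"
  obtains R where "0 < R" "modulus R < e"
proof -
  have "\<forall>\<^sub>F R in sequentially. modulus R < e"
    using modulus(1) assms by (rule order_tendstoD(2))
  then obtain R0 where "\<And>R. R0 \<le> R \<Longrightarrow> modulus R < e"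
    by (auto simp: eventually_sequentially)
  then show thesis
    using that[of "Suc R0"] by simp
qed

lemma endpoint_limit:
  assumes "x \<in> gromov_seqs"
  shows "(\<lambda>i. orb (x i)) \<longlonglongrightarrow> endpoint x"
proof -
  have "Cauchy (\<lambda>i. orb (x i))"
  proof (rule CauchyI)
    fix e :: real assume "0 < e"
    then obtain R where R: "modulus R < e"
      using modulus_small by blast
    obtain N where "\<forall>i\<ge>N. \<forall>j\<ge>N. real R \<le> gp (x i) (x j)"
      using assms unfolding gromov_seqs_iff by blast
    then have "\<forall>i\<ge>N. \<forall>j\<ge>N. norm (orb (x i) - orb (x j)) \<le> modulus R"
      using orb_contraction gromov_seqs_closed[OF assms] by simp
    then have "\<forall>i\<ge>N. \<forall>j\<ge>N. norm (orb (x i) - orb (x j)) < e"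
      using R by (meson le_less_trans)
    then show "\<exists>N. \<forall>i\<ge>N. \<forall>j\<ge>N. norm (orb (x i) - orb (x j)) < e"
      by blast
  qed
  then have "convergent (\<lambda>i. orb (x i))"
    by (rule Cauchy_convergent)
  then show ?thesis
    unfolding endpoint_def by (simp add: convergent_LIMSEQ_iff)
qed

lemma liminf_productD:
  assumes "ereal (real R) < liminf_product (word_dist G s) \<one>\<^bsub>G\<^esub> x y"
  shows "\<exists>N. \<forall>i\<ge>N. real R \<le> gp (x i) (y i)"
proof -
  have "\<forall>\<^sub>F p in sequentially \<times>\<^sub>F sequentially.
      ereal (real R) < (\<lambda>(i, j). ereal (gp (x i) (y j))) p"
    using assms unfolding liminf_product_def by (rule less_LiminfD)
  then obtain N where N: "\<forall>i\<ge>N. \<forall>j\<ge>N. real R < gp (x j) (y i)"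
    by (auto simp: eventually_prod_sequentially)
  have "real R \<le> gp (x i) (y i)" if "N \<le> i" for i
    using N that less_imp_le by blast
  then show ?thesis
    by blast
qed

lemma endpoint_dist:
  assumes "x \<in> gromov_seqs" "y \<in> gromov_seqs"
    and "ereal (real R) < liminf_product (word_dist G s) \<one>\<^bsub>G\<^esub> x y"
  shows "norm (endpoint x - endpoint y) \<le> modulus R"
proof -
  obtain N where N: "\<forall>i\<ge>N. real R \<le> gp (x i) (y i)"
    using liminf_productD[OF assms(3)] by blast
  have "(\<lambda>i. norm (orb (x i) - orb (y i))) \<longlonglongrightarrow> norm (endpoint x - endpoint y)"
    using assms by (intro tendsto_norm tendsto_diff endpoint_limit)
  moreover have "\<forall>i\<ge>N. norm (orb (x i) - orb (y i)) \<le> modulus R"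
    using N orb_contraction gromov_seqs_closed assms by simp
  ultimately show ?thesis
    using LIMSEQ_le_const2 by blast
qed

abbreviation grel :: "((nat \<Rightarrow> 'a) \<times> (nat \<Rightarrow> 'a)) set" where
  "grel \<equiv> gromov_rel (carrier G) (word_dist G s) \<one>\<^bsub>G\<^esub>"

text \<open>The distance of the endpoints is at most the contraction modulus at every \<open>R\<close>.\<close>

lemma endpoint_grel:
  assumes "(x, y) \<in> grel"
  shows "endpoint x = endpoint y"
proof -
  have xy: "x \<in> gromov_seqs" "y \<in> gromov_seqs"
    "liminf_product (word_dist G s) \<one>\<^bsub>G\<^esub> x y = \<infinity>"
    using assms by (simp_all add: gromov_rel_def)
  have "norm (endpoint x - endpoint y) \<le> modulus R" for R
    using endpoint_dist[OF xy(1,2)] xy(3) by simp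
  then have "norm (endpoint x - endpoint y) \<le> 0"
    using modulus(1) by (meson LIMSEQ_le_const)
  then show ?thesis
    by simp
qed

lemma endpoint_trancl:
  assumes "(x, y) \<in> grel\<^sup>+"
  shows "y \<in> gromov_seqs \<and> endpoint x = endpoint y"
  using assms
proof (induction rule: trancl_induct)
  case (base y)
  then show ?case
    using endpoint_grel by (simp add: gromov_rel_def)
next
  case (step y z)
  then show ?case
    using endpoint_grel[of y z] by (simp add: gromov_rel_def)
qed

text \<open>A class of the boundary contains the sequences that generate it.\<close>

lemma grel_refl:
  assumes "x \<in> gromov_seqs"
  shows "(x, x) \<in> grel"
proof -
  have "ereal Z \<le> liminf_product (word_dist G s) \<one>\<^bsub>G\<^esub> x x" for Z
    unfolding liminf_product_def
  proof (rule Liminf_bounded)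
    obtain R where R: "Z \<le> real R"
      using real_arch_simple by blast
    obtain N where "\<forall>i\<ge>N. \<forall>j\<ge>N. real R \<le> gp (x i) (x j)"
      using assms unfolding gromov_seqs_iff by blast
    then have "\<forall>i\<ge>N. \<forall>j\<ge>N. Z \<le> gp (x i) (x j)"
      using R by (meson order_trans)
    then show "\<forall>\<^sub>F p in sequentially \<times>\<^sub>F sequentially. ereal Z \<le> (case p of (i, j) \<Rightarrow> ereal (gp (x i) (x j)))"
      by (auto simp: eventually_prod_sequentially)
  qed
  then have "liminf_product (word_dist G s) \<one>\<^bsub>G\<^esub> x x = \<infinity>"
    by (rule ereal_top)
  then show ?thesis
    using assms by (simp add: gromov_rel_def)
qed

definition boundary_map :: "(nat \<Rightarrow> 'a) set \<Rightarrow> real ^ 'n" where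
  "boundary_map a = endpoint (SOME x. x \<in> a)"

lemma boundary_nonempty:
  assumes "a \<in> group_boundary G s"
  obtains x where "x \<in> a"
proof -
  obtain x where "x \<in> gromov_seqs" "a = grel\<^sup>+ `` {x}"
    using assms unfolding gromov_boundary_def by (elim quotientE)
  then have "x \<in> a"
    using grel_refl by blast
  then show thesis
    by (rule that)
qed

text \<open>All members of a class share their endpoint, so the choice of a representative is immaterial.\<close>

lemma boundary_map_eq:
  assumes "a \<in> group_boundary G s" "y \<in> a"
  shows "y \<in> gromov_seqs" "boundary_map a = endpoint y"
proof -
  obtain x where x: "x \<in> gromov_seqs" "a = grel\<^sup>+ `` {x}"
    using assms(1) unfolding gromov_boundary_def by (elim quotientE)
  have *: "z \<in> gromov_seqs \<and> endpoint z = endpoint x" if "z \<in> a" for z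
    using endpoint_trancl[of x z] that x(2) by simp
  show "y \<in> gromov_seqs"
    using *[OF assms(2)] by blast
  have "(SOME z. z \<in> a) \<in> a"
    by (rule someI[of "\<lambda>z. z \<in> a", OF assms(2)])
  then show "boundary_map a = endpoint y"
    using * assms(2) by (simp add: boundary_map_def)
qed

lemma class_in_boundary:
  assumes "x \<in> gromov_seqs"
  shows "grel\<^sup>+ `` {x} \<in> group_boundary G s" "x \<in> grel\<^sup>+ `` {x}"
  using assms grel_refl by (auto simp: gromov_boundary_def intro: quotientI)


section \<open>Endpoints lie in the limit set\<close>

text \<open>Normalization divides the constant value of the form on the orbit by the square of a height that
  tends to infinity along a Gromov sequence.\<close>

lemma B_orb_limit:
  assumes "x \<in> gromov_seqs"
  shows "(\<lambda>i. B (orb (x i)) (orb (x i))) \<longlonglongrightarrow> 0"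
proof -
  obtain \<eta> :: "nat \<Rightarrow> real" where eta: "\<eta> \<longlonglongrightarrow> 0" "\<forall>u. 1 / orbit_height u \<le> \<eta> (len u)"
    using orbit_height_at_top by blast
  have "\<forall>i. \<exists>u. x i = wp u"
    using wp_surj gromov_seqs_closed[OF assms] by metis
  then obtain u where u: "\<forall>i. x i = wp (u i)"
    by (rule choice[THEN exE])
  have "filterlim (\<lambda>i. len (u i)) at_top sequentially"
    unfolding filterlim_at_top eventually_sequentially
  proof
    fix R
    obtain N where N: "\<forall>i\<ge>N. \<forall>j\<ge>N. real R \<le> gp (x i) (x j)"
      using assms unfolding gromov_seqs_iff by blast
    have "R \<le> len (u i)" if "N \<le> i" for i
    proof -
      have "real R \<le> gp (wp (u i)) (wp (u i))"
        using N that u by simp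
      then show ?thesis
        by (simp add: gp_wp)
    qed
    then show "\<exists>N. \<forall>i\<ge>N. R \<le> len (u i)"
      by blast
  qed
  then have eta_len: "(\<lambda>i. \<eta> (len (u i))) \<longlonglongrightarrow> 0"
    by (rule filterlim_compose[OF eta(1)])
  have inv0: "(\<lambda>i. 1 / orbit_height (u i)) \<longlonglongrightarrow> 0"
  proof (rule tendsto_sandwich[OF _ _ tendsto_const eta_len])
    show "\<forall>\<^sub>F i in sequentially. 0 \<le> 1 / orbit_height (u i)"
      by (simp add: less_imp_le[OF orbit_height_pos])
    show "\<forall>\<^sub>F i in sequentially. 1 / orbit_height (u i) \<le> \<eta> (len (u i))"
      using eta(2) by simp
  qed
  have one: "orbit_height (rev w @ w) = 1" for w
    using orbit_height_cong[OF cong_rev_self] by (simp add: orbit_height_def)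
  have "B (orb (x i)) (orb (x i)) = - lam * (1 / orbit_height (u i) * (1 / orbit_height (u i)))" for i
    using u by (simp add: orb_wp B_orbit_point one)
  moreover have "(\<lambda>i. - lam * (1 / orbit_height (u i) * (1 / orbit_height (u i)))) \<longlonglongrightarrow> - lam * (0 * 0)"
    by (intro tendsto_intros inv0)
  ultimately show ?thesis
    by simp
qed

lemma endpoint_properties:
  assumes "x \<in> gromov_seqs"
  shows "height (endpoint x) = 1" "B (endpoint x) (endpoint x) = 0"
proof -
  have lim: "(\<lambda>i. orb (x i)) \<longlonglongrightarrow> endpoint x"
    by (rule endpoint_limit[OF assms])
  have "(\<lambda>i. height (orb (x i))) \<longlonglongrightarrow> height (endpoint x)"
    unfolding height_inner by (intro tendsto_intros lim)
  moreover have "height (orb (x i)) = 1" for i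
    using wp_surj[OF gromov_seqs_closed[OF assms, of i]] orb_wp height_orbit_point by metis
  ultimately have "(\<lambda>i. 1) \<longlonglongrightarrow> height (endpoint x)"
    by simp
  then show "height (endpoint x) = 1"
    using LIMSEQ_unique tendsto_const by blast
  have "(\<lambda>i. B (orb (x i)) (orb (x i))) \<longlonglongrightarrow> B (endpoint x) (endpoint x)"
    by (intro B.tendsto lim)
  then show "B (endpoint x) (endpoint x) = 0"
    using B_orb_limit[OF assms] LIMSEQ_unique by blast
qed

lemma B_orb_neg:
  assumes "g \<in> carrier G"
  shows "B (orb g) (orb g) < 0"
proof -
  obtain u where u: "g = wp u"
    using wp_surj[OF assms] .
  have "0 < lam * orbit_height (rev u @ u) / (orbit_height u * orbit_height u)"
    using lam_pos orbit_height_pos by simp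
  then show ?thesis
    by (simp add: u orb_wp B_orbit_point)
qed

text \<open>The endpoint is isotropic and orbit points are timelike, so the endpoint is approached by points
  different from it.\<close>

lemma endpoint_in_limit_set:
  assumes "x \<in> gromov_seqs"
  shows "endpoint x \<in> limit_set G s B"
proof -
  have "orb (x i) \<in> orb ` carrier G - {endpoint x}" for i
  proof -
    have "orb (x i) \<noteq> endpoint x"
      using B_orb_neg[OF gromov_seqs_closed[OF assms, of i]] endpoint_properties(2)[OF assms] by auto
    then show ?thesis
      using gromov_seqs_closed[OF assms] by simp
  qed
  then have "endpoint x islimpt orb ` carrier G"
    using endpoint_limit[OF assms] unfolding islimpt_sequential
    by (intro exI[of _ "\<lambda>i. orb (x i)"]) simp
  then show ?thesis
    using endpoint_properties(1)[OF assms] by (simp add: limit_set_def V1_def orb_def[abs_def])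
qed

end


context lorentzian_coxeter_group
begin

section \<open>The boundary map\<close>

lemma topspace_boundary: "topspace (group_boundary_topology G s) = group_boundary G s"
proof
  show "topspace (group_boundary_topology G s) \<subseteq> group_boundary G s"
    by (auto simp: gromov_topology_def)
  show "group_boundary G s \<subseteq> topspace (group_boundary_topology G s)"
  proof
    fix a assume a: "a \<in> group_boundary G s"
    let ?U = "{b \<in> group_boundary G s.
      boundary_product (word_dist G s) \<one>\<^bsub>G\<^esub> a b > ereal 1}"
    have "a \<in> ?U"
      using a by (simp add: boundary_product_def)
    moreover have "?U \<subseteq> topspace (group_boundary_topology G s)"
      unfolding gromov_topology_def using a
      by (intro openin_subset topology_generated_by_Basis) (auto intro!: exI[of _ a] exI[of _ "1 :: real"])
    ultimately show "a \<in> topspace (group_boundary_topology G s)"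
      by blast
  qed
qed

lemma boundary_map_close:
  assumes a: "a \<in> group_boundary G s" and b: "b \<in> group_boundary G s"
    and ab: "a \<noteq> b" and r: "ereal (real R) < boundary_product (word_dist G s) \<one>\<^bsub>G\<^esub> a b"
  shows "norm (boundary_map a - boundary_map b) \<le> modulus R"
proof -
  obtain x where x: "x \<in> a"
    using boundary_nonempty[OF a] .
  obtain y where y: "y \<in> b"
    using boundary_nonempty[OF b] .
  have "boundary_product (word_dist G s) \<one>\<^bsub>G\<^esub> a b
      \<le> (case (x, y) of (x, y) \<Rightarrow> liminf_product (word_dist G s) \<one>\<^bsub>G\<^esub> x y)"
    using ab x y unfolding boundary_product_def by (simp only: if_False) (rule INF_lower, simp)
  then have "ereal (real R) < liminf_product (word_dist G s) \<one>\<^bsub>G\<^esub> x y"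
    using r by simp
  then show ?thesis
    using endpoint_dist[of x y R] boundary_map_eq[OF a x] boundary_map_eq[OF b y] by simp
qed

lemma boundary_map_in_limit_set:
  assumes "a \<in> group_boundary G s"
  shows "boundary_map a \<in> limit_set G s B"
proof -
  obtain x where "x \<in> a"
    using boundary_nonempty[OF assms] .
  then show ?thesis
    using boundary_map_eq[OF assms] endpoint_in_limit_set by metis
qed

text \<open>Choose \<open>R\<close> with modulus below \<open>e\<close>; then the subbasic set of boundary points \<open>b\<close> with \<open>(a|b) > R\<close> is
  mapped into the ball of radius \<open>e\<close> about the image of \<open>a\<close>.\<close>

theorem continuous_boundary_map:
  "continuous_map (group_boundary_topology G s) (top_of_set (limit_set G s B)) boundary_map"
proof -
  let ?X = "group_boundary_topology G s"
  have "openin ?X {a \<in> topspace ?X. boundary_map a \<in> U}" if U: "open U" for U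
  proof (subst openin_subopen, intro ballI)
    fix a assume "a \<in> {a \<in> topspace ?X. boundary_map a \<in> U}"
    then have a: "a \<in> group_boundary G s" "boundary_map a \<in> U"
      by (simp_all add: topspace_boundary)
    obtain e where e: "0 < e" "ball (boundary_map a) e \<subseteq> U"
      by (rule openE[OF U a(2)])
    obtain R where R: "0 < R" "modulus R < e"
      using modulus_small[OF e(1)] .
    let ?T = "{b \<in> group_boundary G s.
      boundary_product (word_dist G s) \<one>\<^bsub>G\<^esub> a b > ereal (real R)}"
    have "openin ?X ?T"
      unfolding gromov_topology_def
    proof (rule topology_generated_by_Basis, unfold mem_Collect_eq, intro exI conjI)
      show "?T = ?T" ..
    qed (use a R in simp_all)
    moreover have "a \<in> ?T"
      using a by (simp add: boundary_product_def)
    moreover have "?T \<subseteq> {a \<in> topspace ?X. boundary_map a \<in> U}"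
    proof
      fix b assume b: "b \<in> ?T"
      have "boundary_map b \<in> ball (boundary_map a) e"
      proof (cases "a = b")
        case False
        then have "norm (boundary_map a - boundary_map b) \<le> modulus R"
          using boundary_map_close[OF a(1)] b by simp
        then show ?thesis
          using R(2) by (simp add: dist_norm)
      qed (use e in simp)
      then show "b \<in> {a \<in> topspace ?X. boundary_map a \<in> U}"
        using b subsetD[OF e(2)] by (simp add: topspace_boundary)
    qed
    ultimately show "\<exists>T. openin ?X T \<and> a \<in> T \<and> T \<subseteq> {a \<in> topspace ?X. boundary_map a \<in> U}"
      by (intro exI conjI)
  qed
  then have "continuous_map ?X euclidean boundary_map"
    unfolding continuous_map_def by (intro conjI allI impI) (simp, simp only: open_openin)
  then show ?thesis
    using boundary_map_in_limit_set
    by (intro continuous_map_into_subtopology) (simp_all add: topspace_boundary)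
qed

text \<open>The common prefix cancels in the word for the quotient of the two elements.\<close>

lemma common_prefix_gp:
  assumes "reduced (p @ u)" "reduced (p @ v)"
  shows "real (length p) \<le> gp (wp (p @ u)) (wp (p @ v))"
proof -
  have "rev u @ (rev p @ p) @ v \<asymp> rev u @ [] @ v"
    by (intro cong_context cong_rev_self)
  then have "len (rev (p @ u) @ (p @ v)) \<le> length (rev u @ v)"
    using len_le by fastforce
  moreover have "len (p @ u) = length p + length u" "len (p @ v) = length p + length v"
    using len_reduced[OF coxeter_cong.refl] assms by simp_all
  ultimately show ?thesis
    unfolding gp_wp by simp
qed

text \<open>Koenig's lemma: infinitely many long words with a common prefix of length \<open>k\<close> continue it with
  only finitely many letters, so infinitely many of them agree in one more letter.\<close>

lemma infinite_prefixes:
  fixes u :: "nat \<Rightarrow> 'n list"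
  assumes fin: "\<And>k. finite {n. length (u n) < k}"
  obtains r where "strict_mono r"
    "\<And>k i j. k \<le> i \<Longrightarrow> k \<le> j \<Longrightarrow> take k (u (r i)) = take k (u (r j))"
    "\<And>k. k \<le> length (u (r k))"
proof -
  define S where "S k q = {n. k \<le> length (u n) \<and> take k (u n) = q}" for k q
  have "\<exists>p :: nat \<Rightarrow> 'n list. \<forall>k. (infinite (S k (p k))) \<and> take k (p (Suc k)) = p k"
  proof (rule dependent_nat_choice)
    show "\<exists>q. infinite (S 0 q)"
      by (intro exI[of _ "[]"]) (simp add: S_def infinite_UNIV_nat)
  next
    fix q k assume inf: "infinite (S k q)"
    have "S k q \<subseteq> {n. length (u n) < Suc k} \<union> (\<Union>i. S (Suc k) (q @ [i]))"
    proof
      fix n assume n: "n \<in> S k q"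
      show "n \<in> {n. length (u n) < Suc k} \<union> (\<Union>i. S (Suc k) (q @ [i]))"
      proof (cases "length (u n) < Suc k")
        case False
        then have "take (Suc k) (u n) = take k (u n) @ [u n ! k]"
          by (intro take_Suc_conv_app_nth) simp
        then show ?thesis
          using n False by (auto simp: S_def)
      qed simp
    qed
    then have "\<not> finite (\<Union>i. S (Suc k) (q @ [i]))"
      using inf fin finite_subset by (metis finite_Un)
    then obtain i where i: "infinite (S (Suc k) (q @ [i]))"
      by auto
    obtain l where "l \<in> S k q"
      using inf by (metis infinite_imp_nonempty ex_in_conv)
    then have "length q = k"
      by (auto simp: S_def)
    then show "\<exists>q'. infinite (S (Suc k) q') \<and> take k q' = q"
      using i by (intro exI[of _ "q @ [i]"]) simp
  qed
  then obtain p :: "nat \<Rightarrow> 'n list" where p: "\<And>k. infinite (S k (p k))" "\<And>k. take k (p (Suc k)) = p k"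
    by blast
  have prefix: "take k (p (k + d)) = p k" for k d
  proof (induction d)
    case 0
    have "take k (take k (p (Suc k))) = take k (p (Suc k))"
      by simp
    then show ?case
      by (simp only: p(2) add_0_right)
  next
    case (Suc d)
    have "take k (p (k + Suc d)) = take k (take (k + d) (p (Suc (k + d))))"
      by (simp add: min_def)
    then show ?case
      using Suc p(2) by simp
  qed
  have "\<exists>r :: nat \<Rightarrow> nat. \<forall>k. r k \<in> S k (p k) \<and> r k < r (Suc k)"
  proof (rule dependent_nat_choice)
    show "\<exists>n. n \<in> S 0 (p 0)"
      using p(1) by (metis infinite_imp_nonempty ex_in_conv)
    fix n k
    show "\<exists>n'. n' \<in> S (Suc k) (p (Suc k)) \<and> n < n'"
      using p(1)[of "Suc k"] unfolding infinite_nat_iff_unbounded by blast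
  qed
  then obtain r :: "nat \<Rightarrow> nat" where r: "\<And>k. r k \<in> S k (p k)" "\<And>k. r k < r (Suc k)"
    by blast
  have take_r: "take k (u (r i)) = p k" if "k \<le> i" for k i
  proof -
    have "take k (u (r i)) = take k (take i (u (r i)))"
      using that by (simp add: min_def)
    also have "take i (u (r i)) = p (k + (i - k))"
      using r(1)[of i] that by (simp add: S_def)
    finally show ?thesis
      by (simp only: prefix)
  qed
  show thesis
  proof (rule that)
    show "strict_mono r"
      using r(2) by (simp add: strict_mono_Suc_iff)
    show "take k (u (r i)) = take k (u (r j))" if "k \<le> i" "k \<le> j" for k i j
      using take_r that by simp
    show "k \<le> length (u (r k))" for k
      using r(1)[of k] by (simp add: S_def)
  qed
qed

text \<open>Each word occurs finitely often in a sequence whose orbit points approach \<open>x\<close> without reaching it,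
  so the lengths tend to infinity and Koenig's lemma applies.\<close>

theorem boundary_map_surj:
  assumes "x \<in> limit_set G s B"
  shows "x \<in> boundary_map ` group_boundary G s"
proof -
  have "x islimpt orb ` carrier G"
    using assms by (simp add: limit_set_def orb_def[abs_def])
  then obtain f where f: "\<forall>n. f n \<in> orb ` carrier G - {x}" "f \<longlonglongrightarrow> x"
    unfolding islimpt_sequential by blast
  have "\<forall>n. \<exists>u. reduced u \<and> f n = orb (wp u)"
  proof
    fix n
    obtain g where "g \<in> carrier G" "f n = orb g"
      using f(1) by blast
    then obtain w where w: "f n = orb (wp w)"
      using wp_surj by metis
    obtain u where u: "w \<asymp> u" "reduced u"
      using ex_reduced by blast
    then show "\<exists>u. reduced u \<and> f n = orb (wp u)"
      using w wp_eq_iff[of w u] by auto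
  qed
  then obtain u where u: "\<forall>n. reduced (u n) \<and> f n = orb (wp (u n))"
    by (rule choice[THEN exE])
  have "finite {n. length (u n) < k}" for k
  proof -
    have "finite {n. u n = w}" for w
    proof (cases "orb (wp w) = x")
      case True
      then have "{n. u n = w} = {}"
        using f(1) u by force
      then show ?thesis
        by simp
    next
      case False
      then have "\<forall>\<^sub>F n in sequentially. f n \<noteq> orb (wp w)"
        using tendsto_imp_eventually_ne[OF f(2)] by metis
      then obtain N where "\<forall>n\<ge>N. f n \<noteq> orb (wp w)"
        by (auto simp: eventually_sequentially)
      then have "{n. u n = w} \<subseteq> {..<N}"
        using u by (auto simp: not_le[symmetric])
      then show ?thesis
        by (rule finite_subset) simp
    qed
    moreover have "finite {w :: 'n list. set w \<subseteq> UNIV \<and> length w \<le> k}"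
      by (rule finite_lists_length_le) simp
    moreover have "{n. length (u n) < k} \<subseteq> (\<Union>w\<in>{w. set w \<subseteq> UNIV \<and> length w \<le> k}. {n. u n = w})"
      by auto
    ultimately show ?thesis
      by (meson finite_UN_I finite_subset)
  qed
  then obtain r where r: "strict_mono r"
    "\<And>k i j. k \<le> i \<Longrightarrow> k \<le> j \<Longrightarrow> take k (u (r i)) = take k (u (r j))"
    "\<And>k. k \<le> length (u (r k))"
    using infinite_prefixes[of u] by metis
  define y where "y i = wp (u (r i))" for i
  have gp_y: "real k \<le> gp (y i) (y j)" if "k \<le> i" "k \<le> j" for k i j
  proof -
    have split: "u (r i) = take k (u (r i)) @ drop k (u (r i))"
      "u (r j) = take k (u (r i)) @ drop k (u (r j))"
      using r(2)[OF that] by (metis append_take_drop_id)+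
    have "length (take k (u (r i))) = k"
      using r(3)[of i] that by simp
    then show ?thesis
      unfolding y_def using common_prefix_gp split u by metis
  qed
  have "y \<in> gromov_seqs"
    unfolding gromov_seqs_iff using gp_y by (auto simp: y_def)
  moreover have "(\<lambda>i. orb (y i)) \<longlonglongrightarrow> x"
  proof -
    have "(f \<circ> r) \<longlonglongrightarrow> x"
      using f(2) r(1) by (rule LIMSEQ_subseq_LIMSEQ)
    then show ?thesis
      using u by (simp add: y_def comp_def)
  qed
  ultimately have "endpoint y = x"
    using endpoint_limit LIMSEQ_unique by blast
  then have "boundary_map (grel\<^sup>+ `` {y}) = x"
    using boundary_map_eq class_in_boundary \<open>y \<in> gromov_seqs\<close> by metis
  then show ?thesis
    using class_in_boundary(1)[OF \<open>y \<in> gromov_seqs\<close>] by blast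
qed

text \<open>The normalization after applying a group element is continuous at an endpoint, since a nonzero
  vector of the light cone has nonzero height.\<close>

theorem boundary_map_equivariant:
  assumes g: "g \<in> carrier G" and a: "a \<in> group_boundary G s"
  shows "normalized_act G s B g (boundary_map a) = boundary_map (boundary_act G g a)"
proof -
  obtain w where w: "g = wp w"
    using wp_surj[OF g] .
  let ?y = "SOME y. y \<in> boundary_act G g a"
  obtain x0 where "x0 \<in> a"
    using boundary_nonempty[OF a] .
  then have "(\<lambda>i. g \<otimes>\<^bsub>G\<^esub> x0 i) \<in> boundary_act G g a"
    by (auto simp: boundary_act_def)
  then have "?y \<in> boundary_act G g a"
    by (rule someI[of "\<lambda>y. y \<in> boundary_act G g a"])
  then obtain x where x: "x \<in> a" "?y = (\<lambda>i. g \<otimes>\<^bsub>G\<^esub> x i)"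
    by (auto simp: boundary_act_def)
  let ?e = "endpoint x"
  have xg: "x \<in> gromov_seqs" and Fa: "boundary_map a = ?e"
    using boundary_map_eq[OF a x(1)] by blast+
  have "B (act w ?e) (act w ?e) = 0"
    using endpoint_properties(2)[OF xg] by (simp add: B_act)
  moreover have "act w ?e \<noteq> 0"
  proof
    assume "act w ?e = 0"
    then have "act (rev w) (act w ?e) = 0"
      using linear_0[OF linear_act] by simp
    then show False
      using endpoint_properties(1)[OF xg] by simp
  qed
  ultimately have nz: "height (act w ?e) \<noteq> 0"
    using norm_le_height[of "act w ?e"] by auto
  have "(\<lambda>i. act w (orb (x i))) \<longlonglongrightarrow> act w ?e"
    using linear_conv_bounded_linear linear_act bounded_linear.tendsto endpoint_limit[OF xg] by blast
  then have "(\<lambda>i. act w (orb (x i)) /\<^sub>R height (act w (orb (x i)))) \<longlonglongrightarrow> act w ?e /\<^sub>R height (act w ?e)"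
    using nz unfolding height_inner by (intro tendsto_intros)
  moreover have "orb (g \<otimes>\<^bsub>G\<^esub> x i) = act w (orb (x i)) /\<^sub>R height (act w (orb (x i)))" for i
    using wp_surj[OF gromov_seqs_closed[OF xg, of i]] orb_mult w by metis
  ultimately have "(\<lambda>i. orb (g \<otimes>\<^bsub>G\<^esub> x i)) \<longlonglongrightarrow> normalized_act G s B g ?e"
    by (simp add: w normalized_act_wp)
  then have "lim (\<lambda>i. orb (g \<otimes>\<^bsub>G\<^esub> x i)) = normalized_act G s B g ?e"
    by (rule limI)
  moreover have "boundary_map (boundary_act G g a) = lim (\<lambda>i. orb (g \<otimes>\<^bsub>G\<^esub> x i))"
    by (simp only: boundary_map_def x(2)) (simp only: endpoint_def)
  ultimately show ?thesis
    by (simp only: Fa)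
qed

end

theorem theorem1p1:
  fixes G :: "('a, 'b) monoid_scheme"
    and s :: "'n::finite \<Rightarrow> 'a"
    and m :: "'n \<Rightarrow> 'n \<Rightarrow> enat"
    and B :: "real ^ 'n \<Rightarrow> real ^ 'n \<Rightarrow> real"
  assumes "coxeter_system G s m"
    and "associated_form m B"
    and "matrix_signature (gram B) = (CARD('n) - 1, 1)"
    and "irreducible_matrix (gram B)"
  shows "\<exists>F. continuous_map (group_boundary_topology G s) (top_of_set (limit_set G s B)) F \<and>
             F ` group_boundary G s = limit_set G s B \<and>
             (\<forall>g\<in>carrier G. \<forall>a\<in>group_boundary G s.
                normalized_act G s B g (F a) = F (boundary_act G g a))"
proof -
  interpret lorentzian_coxeter_group m B G s
    using assms by unfold_locales (simp_all add: coxeter_system_def)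
  have "boundary_map ` group_boundary G s = limit_set G s B"
    using boundary_map_in_limit_set boundary_map_surj by blast
  then show ?thesis
    using continuous_boundary_map boundary_map_equivariant by blast
qed

end
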